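(* Let $\mathbb{T}$ be a time scale with $\sup\mathbb{T}=\infty$, $t_0\in\mathbb{T}$, let $A:[t_0,\infty)_{\mathbb{T}}\to[0,\infty)$ and $\alpha:[t_0,\infty)_{\mathbb{T}}\to\mathbb{T}$ be rd-continuous with $\lim_{t\to\infty}\alpha(t)=\infty$, and consider the delay dynamic equation $$x^{\Delta}(t)+A(t)x(\alpha(t))=0,\qquad t\in[t_0,\infty)_{\mathbb{T}}. \quad (E)$$ Assume that $\alpha(\sigma(t))\le t$ for all $t\in[t_0,\infty)_{\mathbb{T}}$, and that $$\sup_{s\in[t_0,\infty)_{\mathbb{T}}}\int_s^{\alpha_{-1}(s)}A(\eta)\,\Delta\eta<\infty ,\qquad \sup_{s\in[t_0,\infty)_{\mathbb{T}}}\{\alpha_{-1}(s)-s\}<\infty,\qquad \sup_{t\in[t_0,\infty)_{\mathbb{T}}}\int_{\alpha_*(t)}^{t}A(\eta)\,\Delta\eta<1 $$ (these hypotheses imply $1-\mu(t)A(t)>0$ for all $t\in[t_0,\infty)_{\mathbb T}$). Let $\lambda_0\in(0,1)$ be such that $$\int_{\alpha_*(t)}^{t}\mathrm{e}_{\lambda_0(\ominus(-A))}(\sigma(t),\alpha_*(\eta))A(\eta)\,\Delta\eta<1-\lambda_0\quad\text{for all }t\in[t_0,\infty)_{\mathbb{T}}.$$ Moreover, assume that there exist $M_1,\lambda_1>0$ such that $$\mathrm{e}_{-\lambda_0A}(t,s)\le M_1\,\mathrm{e}_{\ominus\lambda_1}(t,s)\quad\text{for all }t,s\in\mathbb{T}\text{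 with }t\ge s\ge t_0 .$$ Then the trivial solution of (E) is uniformly exponentially stable.
   Context: Time scales: a time scale $\mathbb{T}$ is a nonempty closed subset of $\mathbb{R}$; an interval with subscript $\mathbb{T}$ means its intersection with $\mathbb{T}$. $\sigma(t)=\inf(t,\infty)_{\mathbb{T}}$, $\mu(t)=\sigma(t)-t$; $t$ is right-dense if $\mu(t)=0$, right-scattered otherwise; left-dense and left-scattered points are defined similarly with $\rho(t)=\sup(-\infty,t)_{\mathbb{T}}$. $f^{\Delta}(t)$ is the $\Delta$-derivative: the number such that for every $\varepsilon>0$ there is a neighbourhood $U$ of $t$ in $\mathbb T$ with $|f(\sigma(t))-f(r)-f^{\Delta}(t)(\sigma(t)-r)|\le\varepsilon|\sigma(t)-r|$ for all $r\in U$. A function is rd-continuous if it is continuous at right-dense points and has finite limits at left-dense points. The $\Delta$-integral of an rd-continuous $f$ is $\int_s^t f(\eta)\Delta\eta=F(t)-F(s)$ with $F^{\Delta}=f$. For rd-continuous $f$ with $1+\mu f>0$, $\mathrm{e}_f(t,s)=\exp\{\int_s^t\xi_{\mu(\eta)}(f(\eta))\Delta\eta\}$ with $\xi_0(z)=z$ and $\xi_h(z)=\frac1h\ln(1+hz)$ for $h>0$; $\ominus f:=-f/(1+\mu f)$, so $\ominus(-A)=A/(1-\mu A)$. Delay functions: $\alpha_*(t):=\inf\{\alpha(\eta):\eta\in[t,\infty)_{\mathbb{T}}\}$ and $\alpha_{-1}(t):=\sup\{\eta\in[t_0,\infty)_{\mathbb{T}}:\alpha_*(\eta)\le t\}$ for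 $t\in[t_0,\infty)_{\mathbb T}$. Initial value problem: for $s\in[t_0,\infty)_{\mathbb{T}}$, a solution of (E) with data $(s,x_0,\varphi)$ is a function $x:[\alpha_*(s),\infty)_{\mathbb{T}}\to\mathbb{R}$ that is rd-continuous on $[\alpha_*(s),s]_{\mathbb{T}}$, is $\Delta$-differentiable on $[s,\infty)_{\mathbb{T}}$ with an rd-continuous derivative, satisfies $x^{\Delta}(t)+A(t)x(\alpha(t))=0$ identically on $[s,\infty)_{\mathbb{T}}$, and has $x(s)=x_0$ and $x(t)=\varphi(t)$ for $t\in[\alpha_*(s),s)_{\mathbb{T}}$. Uniform exponential stability of the trivial solution: there are $M,\lambda>0$ such that for every $s\in[t_0,\infty)_{\mathbb{T}}$, every solution $x$ with data $(s,x_0,\varphi)$ satisfies $|x(t)|\le M\,\mathrm{e}_{\ominus\lambda}(t,s)\big(|x_0|+\sup_{\eta\in[\alpha_*(s),s)_{\mathbb{T}}}|\varphi(\eta)|\big)$ for all $t\in[s,\infty)_{\mathbb{T}}$.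
   Formalization: The formal theorem also assumes α(t) ≤ t for all t ≥ t₀ (not implied at left-dense right-scattered points, where the claim can fail without it), and starts integrals and exponentials at t₀ when α_* lies before t₀, where A is undefined. *)

theory Defs
  imports Complex_Main "HOL-Library.Extended_Real"
begin

text \<open>
  All notions take the underlying time scale \<open>S\<close> as a parameter.  An interval of a time scale is
  again a time scale, so functions that are only defined on an interval (such as the coefficient on
  \<open>[t\<^sub>0,\<infinity>)\<close>, or a solution on \<open>[s,\<infinity>)\<close>) are handled by passing that
  interval as \<open>S\<close>.
\<close>

definition time_scale :: "real set \<Rightarrow> bool" where
  "time_scale S \<longleftrightarrow> S \<noteq> {} \<and> closed S"

text \<open>The usual conventions \<open>inf \<emptyset> = sup S\<close> and \<open>sup \<emptyset> = inf S\<close> give the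
  value \<open>t\<close> at a maximum respectively minimum \<open>t\<close> of \<open>S\<close>.\<close>

definition fwd_jump :: "real set \<Rightarrow> real \<Rightarrow> real" where
  "fwd_jump S t = (if S \<inter> {t<..} = {} then t else Inf (S \<inter> {t<..}))"

definition bwd_jump :: "real set \<Rightarrow> real \<Rightarrow> real" where
  "bwd_jump S t = (if S \<inter> {..<t} = {} then t else Sup (S \<inter> {..<t}))"

definition graininess :: "real set \<Rightarrow> real \<Rightarrow> real" where
  "graininess S t = fwd_jump S t - t"

text \<open>As usual, a maximum of \<open>S\<close> is not right-dense and a minimum is not left-dense.\<close>

definition right_dense :: "real set \<Rightarrow> real \<Rightarrow> bool" where
  "right_dense S t \<longleftrightarrow> t \<in> S \<and> S \<inter> {t<..} \<noteq> {} \<and> graininess S t = 0"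

definition left_dense :: "real set \<Rightarrow> real \<Rightarrow> bool" where
  "left_dense S t \<longleftrightarrow> t \<in> S \<and> S \<inter> {..<t} \<noteq> {} \<and> bwd_jump S t = t"

definition rd_continuous :: "real set \<Rightarrow> (real \<Rightarrow> real) \<Rightarrow> bool" where
  "rd_continuous S f \<longleftrightarrow>
     (\<forall>t\<in>S. right_dense S t \<longrightarrow> continuous (at t within S) f) \<and>
     (\<forall>t\<in>S. left_dense S t \<longrightarrow> (\<exists>L. (f \<longlongrightarrow> L) (at t within (S \<inter> {..<t}))))"

definition has_delta_derivative :: "real set \<Rightarrow> (real \<Rightarrow> real) \<Rightarrow> real \<Rightarrow> real \<Rightarrow> bool" where
  "has_delta_derivative S f D t \<longleftrightarrow>
     (\<forall>\<epsilon>>0. \<exists>U. open U \<and> t \<in> U \<and>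
        (\<forall>r\<in>U \<inter> S. \<bar>f (fwd_jump S t) - f r - D * (fwd_jump S t - r)\<bar>
                        \<le> \<epsilon> * \<bar>fwd_jump S t - r\<bar>))"

text \<open>Meant for \<open>f\<close> with an antiderivative on \<open>S\<close> (e.g. rd-continuous \<open>f\<close>), \<open>S\<close> a time scale
  without maximum and \<open>s, t \<in> S\<close>; the antiderivative is then unique up to a constant.  An integral
  over \<open>[s,t]\<close> with \<open>s\<close> left of the domain \<open>[t\<^sub>0,\<infinity>)\<close> of the integrand is written
  with lower limit \<open>max t\<^sub>0 s\<close>, i.e. the integrand is read as \<open>0\<close> before \<open>t\<^sub>0\<close>.\<close>

definition delta_integral :: "real set \<Rightarrow> (real \<Rightarrow> real) \<Rightarrow> real \<Rightarrow> real \<Rightarrow> real" where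
  "delta_integral S f s t =
     (THE I. \<exists>F. (\<forall>u\<in>S. has_delta_derivative S F (f u) u) \<and> I = F t - F s)"

definition cylinder :: "real \<Rightarrow> real \<Rightarrow> real" where
  "cylinder h z = (if h = 0 then z else ln (1 + h * z) / h)"

definition ts_exp :: "real set \<Rightarrow> (real \<Rightarrow> real) \<Rightarrow> real \<Rightarrow> real \<Rightarrow> real" where
  "ts_exp S f t s = exp (delta_integral S (\<lambda>\<eta>. cylinder (graininess S \<eta>) (f \<eta>)) s t)"

definition circle_minus :: "real set \<Rightarrow> (real \<Rightarrow> real) \<Rightarrow> real \<Rightarrow> real" where
  "circle_minus S f t = - f t / (1 + graininess S t * f t)"

text \<open>\<open>\<alpha>\<close> is a delay function, \<open>\<alpha> t \<le> t\<close>.  This does not follow from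
  \<open>\<alpha> (fwd_jump T t) \<le> t\<close>, which says nothing about \<open>\<alpha>\<close> at points that are left-dense and
  right-scattered.\<close>

definition delay_star :: "real set \<Rightarrow> (real \<Rightarrow> real) \<Rightarrow> real \<Rightarrow> real" where
  "delay_star T \<alpha> t = Inf (\<alpha> ` (T \<inter> {t..}))"

definition delay_inv :: "real set \<Rightarrow> real \<Rightarrow> (real \<Rightarrow> real) \<Rightarrow> real \<Rightarrow> real" where
  "delay_inv T t\<^sub>0 \<alpha> t = Sup {\<eta> \<in> T \<inter> {t\<^sub>0..}. delay_star T \<alpha> \<eta> \<le> t}"

text \<open>The history \<open>\<phi>\<close> and the value \<open>x\<^sub>0\<close> are independent data, so \<open>x\<close> may jump at \<open>s\<close>;
  accordingly differentiability at \<open>s\<close> is relative to \<open>[s,\<infinity>)\<close>, and rd-continuity at the right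
  end point \<open>s\<close> of the history interval only asks for a left limit.\<close>

definition delay_solution ::
  "real set \<Rightarrow> (real \<Rightarrow> real) \<Rightarrow> (real \<Rightarrow> real) \<Rightarrow> real \<Rightarrow> real \<Rightarrow> (real \<Rightarrow> real) \<Rightarrow> (real \<Rightarrow> real) \<Rightarrow> bool"
where
  "delay_solution T A \<alpha> s x\<^sub>0 \<phi> x \<longleftrightarrow>
     rd_continuous (T \<inter> {delay_star T \<alpha> s..s}) x \<and>
     (\<exists>x'. (\<forall>t\<in>T \<inter> {s..}. has_delta_derivative (T \<inter> {s..}) x (x' t) t) \<and>
           rd_continuous (T \<inter> {s..}) x' \<and>
           (\<forall>t\<in>T \<inter> {s..}. x' t + A t * x (\<alpha> t) = 0)) \<and>
     x s = x\<^sub>0 \<and>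
     (\<forall>t\<in>T \<inter> {delay_star T \<alpha> s..<s}. x t = \<phi> t)"

text \<open>The inserted \<open>0\<close> makes the supremum over the empty set \<open>0\<close>; it matters when
  \<open>delay_star T \<alpha> s = s\<close>.  For the history of a solution the set is bounded, by rd-continuity.\<close>

definition sup_abs :: "real set \<Rightarrow> (real \<Rightarrow> real) \<Rightarrow> real" where
  "sup_abs I \<phi> = Sup (insert 0 ((\<lambda>\<eta>. \<bar>\<phi> \<eta>\<bar>) ` I))"

definition uniformly_exponentially_stable ::
  "real set \<Rightarrow> real \<Rightarrow> (real \<Rightarrow> real) \<Rightarrow> (real \<Rightarrow> real) \<Rightarrow> bool"
where
  "uniformly_exponentially_stable T t\<^sub>0 A \<alpha> \<longleftrightarrow>
     (\<exists>M>0. \<exists>\<Lambda>>0. \<forall>s\<in>T \<inter> {t\<^sub>0..}. \<forall>x\<^sub>0 \<phi> x. delay_solution T A \<alpha> s x\<^sub>0 \<phi> x \<longrightarrow>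
        (\<forall>t\<in>T \<inter> {s..}.
           \<bar>x t\<bar> \<le> M * ts_exp (T \<inter> {t\<^sub>0..}) (circle_minus (T \<inter> {t\<^sub>0..}) (\<lambda>_. \<Lambda>)) t s
                     * (\<bar>x\<^sub>0\<bar> + sup_abs (T \<inter> {delay_star T \<alpha> s..<s}) \<phi>)))"

end

theory Submission
  imports Defs "HOL-Analysis.Analysis"
begin

text \<open>
  Write \<open>w = e\<^bsub>-\<lambda>\<^sub>0A\<^esub>(\<cdot>,s)\<close>.  Since
  \<open>x\<^sup>\<Delta> + A x = A (x - x \<circ> \<alpha>)\<close> and \<open>x - x \<circ> \<alpha>\<close> is an integral of
  \<open>A \<cdot> (x \<circ> \<alpha>)\<close> over \<open>[\<alpha>(t), t]\<close>, a bound \<open>\<bar>x\<bar> < C w\<close> on the past gives, by the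
  hypothesis on \<open>\<lambda>\<^sub>0\<close> and \<open>1/e\<^bsub>-\<lambda>\<^sub>0A\<^esub> \<le> e\<^bsub>\<lambda>\<^sub>0(\<ominus>(-A))\<^esub>\<close>, the inequality
  \<open>\<bar>x\<^sup>\<Delta> + A x\<bar> \<le> (1 - \<lambda>\<^sub>0) A C w = (C w)\<^sup>\<Delta> + A C w\<close>.  Hence \<open>(C w \<plusminus> x)/e\<^bsub>-A\<^esub>\<close> is
  nondecreasing and the bound propagates.  This needs \<open>\<alpha> \<ge> s\<close>, that is, \<open>t\<close> beyond
  \<open>\<alpha>\<^sub>-\<^sub>1(s)\<close>; up to \<open>\<sigma>(\<alpha>\<^sub>-\<^sub>1(s))\<close> the solution is controlled by a Gronwall estimate, as the
  integral of \<open>A\<close> over that stretch is bounded uniformly in \<open>s\<close>.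
\<close>

subsection \<open>Jumps, induction and delta derivatives\<close>

text \<open>All bounds are propagated in strict form. A strict inequality between continuous
  functions persists to the right of a right-dense point, but at a left-dense point a passage to the
  limit would leave only a weak one. The quotient by e_{-A} is there for this: being nondecreasing,
  it cannot sink below its positive starting value. The price of strictness is that the size of the
  data is replaced by an arbitrary larger number, which is let go at the very end. The Gronwall
  estimate is the same comparison, run with the growing function e_A in place of C w. In the late
  phase the values in the history obey the bound C w as well: w is nonincreasing, so its extension
  to the left of \<open>s\<close> is at least w(s), and before \<open>t\<^sub>0\<close> it is read
  as the value at \<open>t\<^sub>0\<close>. Since the hypothesis on \<open>lam\<^sub>0\<close> has
  \<sigma>(t) as the upper argument of its exponential, the estimate first produces w(\<sigma>(t)),
  which is then replaced by the larger w(t). Integrals are handled throughout as differences of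
  antiderivatives, and estimated by comparing derivatives.\<close>

lemma fwd_jump_ge: "t \<le> fwd_jump S t"
  unfolding fwd_jump_def by (auto intro!: cInf_greatest)

lemma fwd_jump_le: "r \<in> S \<Longrightarrow> t < r \<Longrightarrow> fwd_jump S t \<le> r"
  unfolding fwd_jump_def by (auto intro!: cInf_lower bdd_belowI[of _ t])

lemma fwd_jump_mem: "closed S \<Longrightarrow> t \<in> S \<Longrightarrow> fwd_jump S t \<in> S"
proof -
  assume S: "closed S" "t \<in> S"
  have "Inf (S \<inter> {t<..}) \<in> S" if "S \<inter> {t<..} \<noteq> {}"
    by (rule closed_subset_contains_Inf[OF S(1)]) (use that in \<open>auto intro!: bdd_belowI[of _ t]\<close>)
  then show ?thesis using S by (auto simp: fwd_jump_def)
qed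

lemma fwd_jump_dense:
  assumes "fwd_jump S t = t" "r \<in> S" "t < r" "t < b"
  obtains q where "q \<in> S" "t < q" "q < b"
proof -
  have "Inf (S \<inter> {t<..}) < b"
    using assms by (auto simp: fwd_jump_def split: if_splits)
  then show ?thesis
    using cInf_lessD[of "S \<inter> {t<..}" b] assms that by auto
qed

lemma fwd_jump_eqI:
  assumes "r \<in> S" "t < r" "\<And>q. q \<in> S \<Longrightarrow> t < q \<Longrightarrow> r \<le> q"
  shows "fwd_jump S t = r"
proof -
  have "Inf (S \<inter> {t<..}) = r"
    by (rule cInf_eq_minimum) (use assms in auto)
  then show ?thesis using assms by (auto simp: fwd_jump_def)
qed

lemma fwd_jump_Int_atLeast: "s \<le> t \<Longrightarrow> fwd_jump (S \<inter> {s..}) t = fwd_jump S t"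
proof -
  assume "s \<le> t"
  then have "S \<inter> {s..} \<inter> {t<..} = S \<inter> {t<..}" by auto
  then show ?thesis by (simp add: fwd_jump_def)
qed

lemma graininess_nonneg: "0 \<le> graininess S t"
  using fwd_jump_ge[of t S] by (simp add: graininess_def)

lemma right_dense_iff: "right_dense S t \<longleftrightarrow> t \<in> S \<and> S \<inter> {t<..} \<noteq> {} \<and> fwd_jump S t = t"
  by (simp add: right_dense_def graininess_def)

lemma left_dense_iff:
  "left_dense S t \<longleftrightarrow> t \<in> S \<and> (\<forall>d<t. \<exists>r\<in>S. d < r \<and> r < t)"
proof
  assume L: "left_dense S t"
  then have "Sup (S \<inter> {..<t}) = t" "S \<inter> {..<t} \<noteq> {}" "t \<in> S"
    by (auto simp: left_dense_def bwd_jump_def split: if_splits)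
  then show "t \<in> S \<and> (\<forall>d<t. \<exists>r\<in>S. d < r \<and> r < t)"
    using less_cSupD[of "S \<inter> {..<t}"] by fastforce
next
  assume R: "t \<in> S \<and> (\<forall>d<t. \<exists>r\<in>S. d < r \<and> r < t)"
  then obtain r where r: "r \<in> S" "r < t" by (meson lt_ex)
  have "Sup (S \<inter> {..<t}) = t"
  proof (rule cSup_eq_non_empty)
    fix y assume "\<And>x. x \<in> S \<inter> {..<t} \<Longrightarrow> x \<le> y"
    with R show "t \<le> y" by (metis IntI leD leI lessThan_iff)
  qed (use r in auto)
  with R r show "left_dense S t"
    by (auto simp: left_dense_def bwd_jump_def)
qed

text \<open>The infimum \<open>m\<close> of the failing points lies in the closed set
  \<open>S\<close>, and \<open>P\<close> holds before \<open>m\<close>. It holds at \<open>m\<close>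
  too, by \<open>left_dense\<close> or by a jump from the predecessor of \<open>m\<close>. So
  failing points would accumulate at \<open>m\<close> from the right, which \<open>scattered\<close>
  or \<open>right_dense\<close> excludes. The induction hypotheses cover the whole past because the
  delay reaches back into it.\<close>

lemma time_scale_induct [consumes 4, case_names base scattered right_dense left_dense]:
  fixes S :: "real set"
  assumes "closed S" "a \<in> S" "b \<in> S" "a \<le> b"
    and base: "P a"
    and scattered: "\<And>t. \<lbrakk>t \<in> S; a \<le> t; t < b; t < fwd_jump S t; \<And>r. r \<in> S \<Longrightarrow> a \<le> r \<Longrightarrow> r \<le> t \<Longrightarrow> P r\<rbrakk>
                  \<Longrightarrow> P (fwd_jump S t)"
    and right_dense: "\<And>t. \<lbrakk>t \<in> S; a \<le> t; t < b; fwd_jump S t = t; \<And>r. r \<in> S \<Longrightarrow> a \<le> r \<Longrightarrow> r \<le> t \<Longrightarrow> P r\<rbrakk>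
                  \<Longrightarrow> \<forall>\<^sub>F r in at t within S \<inter> {t<..}. P r"
    and left_dense: "\<And>t. \<lbrakk>t \<in> S; a < t; t \<le> b; left_dense S t; \<And>r. r \<in> S \<Longrightarrow> a \<le> r \<Longrightarrow> r < t \<Longrightarrow> P r\<rbrakk>
                  \<Longrightarrow> P t"
  shows "P b"
proof (rule ccontr)
  assume nb: "\<not> P b"
  define N where "N = {r \<in> S. a \<le> r \<and> r \<le> b \<and> \<not> P r}"
  define m where "m = Inf N"
  have bN: "b \<in> N" using nb assms by (auto simp: N_def)
  have bdd: "bdd_below N" by (auto simp: N_def intro!: bdd_belowI[of _ a])
  have mS: "m \<in> S" unfolding m_def
    by (rule closed_subset_contains_Inf[OF \<open>closed S\<close>]) (use bN bdd in \<open>auto simp: N_def\<close>)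
  have am: "a \<le> m" unfolding m_def
    by (rule cInf_greatest) (use bN in \<open>auto simp: N_def\<close>)
  have mb: "m \<le> b" unfolding m_def by (rule cInf_lower[OF bN bdd])
  have below: "P r" if "r \<in> S" "a \<le> r" "r < m" for r
  proof (rule ccontr)
    assume "\<not> P r"
    then have "r \<in> N" using that mb by (auto simp: N_def)
    then have "m \<le> r" unfolding m_def by (rule cInf_lower[OF _ bdd])
    then show False using that by simp
  qed
  have Pm: "P m"
  proof (cases "m = a")
    case True
    then show ?thesis using base by simp
  next
    case False
    then have "a < m" using am by simp
    show ?thesis
    proof (cases "left_dense S m")
      case True
      then show ?thesis using left_dense[of m] mS \<open>a < m\<close> mb below by blast
    next
      case False
      then obtain d where d: "d < m" "\<And>r. r \<in> S \<Longrightarrow> r < m \<Longrightarrow> r \<le> d"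
        using mS by (force simp: left_dense_iff)
      \<comment> \<open>As \<open>m\<close> is not left-dense, this supremum stays below
        \<open>m\<close>: it is the predecessor of \<open>m\<close> in \<open>S\<close>, and its
        forward jump lands on \<open>m\<close>.\<close>
      define t where "t = Sup (S \<inter> {..<m})"
      have ne: "S \<inter> {..<m} \<noteq> {}" using \<open>a < m\<close> \<open>a \<in> S\<close> by auto
      have bd: "bdd_above (S \<inter> {..<m})" by (auto intro!: bdd_aboveI[of _ m])
      have tS: "t \<in> S" unfolding t_def
        by (rule closed_subset_contains_Sup[OF \<open>closed S\<close> _ ne bd]) auto
      have "t \<le> d" unfolding t_def by (rule cSup_least[OF ne]) (use d in auto)
      then have tm: "t < m" using d by simp
      have upper: "r \<le> t" if "r \<in> S" "r < m" for r
        unfolding t_def by (rule cSup_upper[OF _ bd]) (use that in auto)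
      have "a \<le> t" using upper \<open>a < m\<close> \<open>a \<in> S\<close> by blast
      have "fwd_jump S t = m"
        by (rule fwd_jump_eqI[OF mS tm]) (use upper in force)
      then show ?thesis using scattered[of t] tS \<open>a \<le> t\<close> tm mb below by auto
    qed
  qed
  have upto: "P r" if "r \<in> S" "a \<le> r" "r \<le> m" for r
    using that below Pm by (cases "r = m") auto
  have "m < b" using Pm nb mb by (cases "m = b") auto
  have "\<not> m < fwd_jump S m"
  proof
    assume lt: "m < fwd_jump S m"
    then have Pj: "P (fwd_jump S m)" using scattered[of m] mS am \<open>m < b\<close> upto by blast
    obtain q where "q \<in> N" "q < fwd_jump S m"
      using cInf_lessD[of N "fwd_jump S m"] bN lt by (auto simp: m_def)
    then have "m < q" using upto by (force simp: N_def)
    then show False using \<open>q \<in> N\<close> \<open>q < fwd_jump S m\<close> fwd_jump_le[of q S m] by (auto simp: N_def)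
  qed
  then have "fwd_jump S m = m" using fwd_jump_ge[of m S] by simp
  then have "\<forall>\<^sub>F r in at m within S \<inter> {m<..}. P r"
    using right_dense[of m] mS am \<open>m < b\<close> upto by blast
  then obtain d where d: "d > 0" "\<And>r. r \<in> S \<Longrightarrow> m < r \<Longrightarrow> dist r m < d \<Longrightarrow> P r"
    by (force simp: eventually_at)
  obtain q where q: "q \<in> N" "q < m + d"
    using cInf_lessD[of N "m + d"] bN d by (auto simp: m_def)
  then have "m < q" using upto by (force simp: N_def)
  then show False using q d(2)[of q] by (auto simp: N_def dist_real_def)
qed

text \<open>Replaces the epsilon definition by three conditions that combine with the calculus of
  the library. The jump identity holds at every point, trivially at dense ones, so that most later
  arguments need no case distinction. At a scattered point the quotient condition reduces to
  continuity, because the denominator stays away from 0.\<close>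

lemma has_delta_derivative_iff:
  assumes "t \<in> S"
  shows "has_delta_derivative S f D t \<longleftrightarrow>
     continuous (at t within S) f \<and> f (fwd_jump S t) = f t + graininess S t * D \<and>
     (fwd_jump S t = t \<longrightarrow> (f has_real_derivative D) (at t within S))"
proof (intro iffI conjI impI)
  let ?\<sigma> = "fwd_jump S t"
  assume h: "has_delta_derivative S f D t"
  have nb: "\<exists>d>0. \<forall>r\<in>S. dist r t < d \<longrightarrow> \<bar>f ?\<sigma> - f r - D * (?\<sigma> - r)\<bar> \<le> e * \<bar>?\<sigma> - r\<bar>" if e: "e > 0" for e
  proof -
    from h[unfolded has_delta_derivative_def, rule_format, OF e]
    obtain U where U: "open U" "t \<in> U"
      "\<forall>r\<in>U \<inter> S. \<bar>f ?\<sigma> - f r - D * (?\<sigma> - r)\<bar> \<le> e * \<bar>?\<sigma> - r\<bar>"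
      by (elim exE conjE)
    obtain d where d: "d > 0" "ball t d \<subseteq> U" using U(1,2) openE by metis
    show ?thesis
    proof (intro exI conjI ballI impI)
      fix r assume "r \<in> S" "dist r t < d"
      then have "r \<in> U \<inter> S" using d(2) by (auto simp: dist_commute)
      then show "\<bar>f ?\<sigma> - f r - D * (?\<sigma> - r)\<bar> \<le> e * \<bar>?\<sigma> - r\<bar>" using U(3) by (rule bspec[rotated])
    qed (rule d(1))
  qed
  \<comment> \<open>The choice r = t in the definition forces the jump identity. The added 1 covers
    the case \<sigma>(t) = t.\<close>
  have le_e: "\<bar>f ?\<sigma> - f t - D * (?\<sigma> - t)\<bar> \<le> e" if "e > 0" for e
  proof -
    have "e / (\<bar>?\<sigma> - t\<bar> + 1) > 0" using that by simp
    from nb[OF this] have "\<bar>f ?\<sigma> - f t - D * (?\<sigma> - t)\<bar> \<le> e / (\<bar>?\<sigma> - t\<bar> + 1) * \<bar>?\<sigma> - t\<bar>"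
      using assms by force
    also have "\<dots> \<le> e" using that by (simp add: field_simps)
    finally show ?thesis .
  qed
  have "\<bar>f ?\<sigma> - f t - D * (?\<sigma> - t)\<bar> \<le> 0"
    by (rule field_le_epsilon) (simp only: add_0 le_e)
  then have "f ?\<sigma> - f t - D * (?\<sigma> - t) = 0" by simp
  then show jump: "f ?\<sigma> = f t + graininess S t * D"
    unfolding graininess_def by argo
  show "continuous (at t within S) f"
    unfolding continuous_within_eps_delta
  proof (intro allI impI)
    fix e :: real assume "e > 0"
    define c where "c = \<bar>?\<sigma> - t\<bar> + 1"
    have c: "c > 0" by (simp add: c_def)
    have "e / (2 * c) > 0" using \<open>e > 0\<close> c by simp
    from nb[OF this] obtain d where d: "d > 0" "\<And>r. r \<in> S \<Longrightarrow> dist r t < d \<Longrightarrow>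
        \<bar>f ?\<sigma> - f r - D * (?\<sigma> - r)\<bar> \<le> e / (2 * c) * \<bar>?\<sigma> - r\<bar>" by metis
    \<comment> \<open>The bound 1 keeps |\<sigma>(t) - r| below \<open>c\<close>, so the derivative
      condition contributes at most e/2. The last bound does the same for the linear term
      \<open>D * (t - r)\<close>.\<close>
    define d' where "d' = min (min d 1) (e / (2 * (\<bar>D\<bar> + 1)))"
    have "d' > 0" using d \<open>e > 0\<close> by (simp add: d'_def)
    moreover have "dist (f r) (f t) < e" if "r \<in> S" "dist r t < d'" for r
    proof -
      have r: "\<bar>r - t\<bar> < d" "\<bar>r - t\<bar> < 1" "\<bar>r - t\<bar> < e / (2 * (\<bar>D\<bar> + 1))"
        using that(2) by (auto simp: d'_def dist_real_def)
      have "\<bar>f t - f r - D * (t - r)\<bar> \<le> e / (2 * c) * \<bar>?\<sigma> - r\<bar>"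
        using d(2)[OF that(1)] r(1) jump by (simp add: dist_real_def graininess_def algebra_simps)
      also have "\<dots> \<le> e / (2 * c) * c"
        by (rule mult_left_mono) (use r(2) c \<open>e > 0\<close> in \<open>auto simp: c_def\<close>)
      also have "\<dots> = e / 2" using c by simp
      finally have 1: "\<bar>f t - f r - D * (t - r)\<bar> \<le> e / 2" .
      have "\<bar>D * (t - r)\<bar> \<le> (\<bar>D\<bar> + 1) * \<bar>r - t\<bar>"
        by (simp add: abs_mult abs_minus_commute mult_right_mono)
      also have "\<dots> < e / 2" using r(3) by (simp add: field_simps)
      finally have "\<bar>f t - f r - D * (t - r)\<bar> + \<bar>D * (t - r)\<bar> < e" using 1 by simp
      moreover have "\<bar>f t - f r\<bar> \<le> \<bar>f t - f r - D * (t - r)\<bar> + \<bar>D * (t - r)\<bar>"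
        using abs_triangle_ineq[of "f t - f r - D * (t - r)" "D * (t - r)"] by simp
      ultimately show ?thesis by (simp add: dist_real_def abs_minus_commute)
    qed
    ultimately show "\<exists>d>0. \<forall>x'\<in>S. dist x' t < d \<longrightarrow> dist (f x') (f t) < e" by blast
  qed
  assume st: "?\<sigma> = t"
  show "(f has_real_derivative D) (at t within S)"
    unfolding has_field_derivative_def has_derivative_within_alt
  proof (intro conjI allI impI bounded_linear_mult_right)
    fix e :: real assume "e > 0"
    from nb[OF this] obtain d where d: "d > 0" "\<And>r. r \<in> S \<Longrightarrow> dist r t < d \<Longrightarrow>
        \<bar>f t - f r - D * (t - r)\<bar> \<le> e * \<bar>t - r\<bar>" unfolding st by metis
    have "norm (f y - f t - D * (y - t)) \<le> e * norm (y - t)" if "y \<in> S" "norm (y - t) < d" for y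
    proof -
      have "\<bar>f t - f y - D * (t - y)\<bar> \<le> e * \<bar>t - y\<bar>" using d(2)[OF that(1)] that(2) by (simp add: dist_real_def)
      moreover have "\<bar>f y - f t - D * (y - t)\<bar> = \<bar>f t - f y - D * (t - y)\<bar>"
        by (subst abs_minus_cancel[symmetric]) (simp add: algebra_simps)
      ultimately show ?thesis by (simp add: abs_minus_commute)
    qed
    then show "\<exists>d>0. \<forall>y\<in>S. norm (y - t) < d \<longrightarrow> norm (f y - f t - D * (y - t)) \<le> e * norm (y - t)"
      using d(1) by blast
  qed
next
  let ?\<sigma> = "fwd_jump S t"
  assume h: "continuous (at t within S) f \<and> f ?\<sigma> = f t + graininess S t * D \<and>
     (?\<sigma> = t \<longrightarrow> (f has_real_derivative D) (at t within S))"
  show "has_delta_derivative S f D t"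
    unfolding has_delta_derivative_def
  proof (intro allI impI)
    fix e :: real assume e: "e > 0"
    have "\<exists>d>0. \<forall>r\<in>S. dist r t < d \<longrightarrow> \<bar>f ?\<sigma> - f r - D * (?\<sigma> - r)\<bar> \<le> e * \<bar>?\<sigma> - r\<bar>"
    proof (cases "?\<sigma> = t")
      case True
      then have "(f has_derivative (*) D) (at t within S)" using h by (simp add: has_field_derivative_def)
      then obtain d where d: "d > 0" "\<And>r. r \<in> S \<Longrightarrow> norm (r - t) < d \<Longrightarrow>
          norm (f r - f t - D * (r - t)) \<le> e * norm (r - t)"
        using e unfolding has_derivative_within_alt by metis
      have "\<bar>f t - f y - D * (t - y)\<bar> \<le> e * \<bar>t - y\<bar>" if "y \<in> S" "dist y t < d" for y
      proof -
        have "\<bar>f y - f t - D * (y - t)\<bar> \<le> e * \<bar>y - t\<bar>" using d(2)[OF that(1)] that(2) by (simp add: dist_real_def)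
        moreover have "\<bar>f y - f t - D * (y - t)\<bar> = \<bar>f t - f y - D * (t - y)\<bar>"
          by (subst abs_minus_cancel[symmetric]) (simp add: algebra_simps)
        ultimately show ?thesis by (simp add: abs_minus_commute)
      qed
      then show ?thesis using True d(1) by auto
    next
      case False
      define \<mu> where "\<mu> = ?\<sigma> - t"
      have \<mu>: "\<mu> > 0" using False fwd_jump_ge[of t S] by (simp add: \<mu>_def)
      have j: "f ?\<sigma> = f t + \<mu> * D" using h by (simp add: \<mu>_def graininess_def)
      have "continuous (at t within S) (\<lambda>r. f r - D * r)"
        using h by (intro continuous_intros) auto
      moreover have "e * \<mu> > 0" using e \<mu> by simp
      ultimately obtain d where d: "d > 0" "\<And>r. r \<in> S \<Longrightarrow> dist r t < d \<Longrightarrow>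
          dist (f r - D * r) (f t - D * t) < e * \<mu>"
        unfolding continuous_within_eps_delta by metis
      have "\<bar>f ?\<sigma> - f r - D * (?\<sigma> - r)\<bar> \<le> e * \<bar>?\<sigma> - r\<bar>" if "r \<in> S" "dist r t < min d \<mu>" for r
      proof -
        \<comment> \<open>No point of \<open>S\<close> lies strictly between t and t + \<mu>, so a
          nearby r is at most t and its distance to \<sigma>(t) is at least \<mu>.\<close>
        have "\<not> t < r" using fwd_jump_le[OF that(1), of t] that(2) by (auto simp: \<mu>_def dist_real_def)
        then have rt: "\<mu> \<le> \<bar>?\<sigma> - r\<bar>" by (simp add: \<mu>_def)
        have "f ?\<sigma> - f r - D * (?\<sigma> - r) = (f t - D * t) - (f r - D * r)"
          using j by (simp add: \<mu>_def algebra_simps)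
        then have "\<bar>f ?\<sigma> - f r - D * (?\<sigma> - r)\<bar> \<le> e * \<mu>"
          using d(2)[OF that(1)] that(2) by (simp add: dist_real_def)
        also have "\<dots> \<le> e * \<bar>?\<sigma> - r\<bar>" using rt e by simp
        finally show ?thesis .
      qed
      then show ?thesis using d(1) \<mu> by (intro exI[of _ "min d \<mu>"]) auto
    qed
    then obtain d where "d > 0" "\<forall>r\<in>S. dist r t < d \<longrightarrow> \<bar>f ?\<sigma> - f r - D * (?\<sigma> - r)\<bar> \<le> e * \<bar>?\<sigma> - r\<bar>"
      by (elim exE conjE)
    then show "\<exists>U. open U \<and> t \<in> U \<and> (\<forall>r\<in>U \<inter> S. \<bar>f ?\<sigma> - f r - D * (?\<sigma> - r)\<bar> \<le> e * \<bar>?\<sigma> - r\<bar>)"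
      by (intro exI[of _ "ball t d"]) (auto simp: dist_commute)
  qed
qed

lemma has_delta_derivative_restrict:
  assumes "has_delta_derivative S f D t" "s \<le> t"
  shows "has_delta_derivative (S \<inter> {s..}) f D t"
  using assms(1) unfolding has_delta_derivative_def fwd_jump_Int_atLeast[OF assms(2)]
  by (meson IntE IntI)

text \<open>Induction on \<open>g a - e * (t - a) \<le> g t\<close>. The slack of slope
  \<open>e\<close> absorbs the error of the linear approximation at right-dense points, where a
  derivative \<open>D \<ge> 0\<close> alone would not give monotonicity nearby. Left-dense points
  follow from continuity.\<close>

lemma time_scale_mono:
  fixes g :: "real \<Rightarrow> real"
  assumes "closed S" "a \<in> S" "b \<in> S" "a \<le> b"
    and cont: "\<And>t. t \<in> S \<Longrightarrow> a \<le> t \<Longrightarrow> t \<le> b \<Longrightarrow> continuous (at t within S) g"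
    and scattered: "\<And>t. t \<in> S \<Longrightarrow> a \<le> t \<Longrightarrow> t < b \<Longrightarrow> t < fwd_jump S t \<Longrightarrow> g t \<le> g (fwd_jump S t)"
    and dense: "\<And>t. t \<in> S \<Longrightarrow> a \<le> t \<Longrightarrow> t < b \<Longrightarrow> fwd_jump S t = t \<Longrightarrow>
                  \<exists>D\<ge>0. (g has_real_derivative D) (at t within S)"
  shows "g a \<le> g b"
proof (rule field_le_epsilon)
  fix e0 :: real assume "e0 > 0"
  \<comment> \<open>Chosen so that the total slack \<open>e * (b - a)\<close> is at most
    \<open>e0\<close>; the 1 covers \<open>a = b\<close>.\<close>
  define e where "e = e0 / (b - a + 1)"
  have e: "e > 0" using \<open>e0 > 0\<close> \<open>a \<le> b\<close> by (simp add: e_def)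
  have "g a - e * (b - a) \<le> g b"
    using assms(1-4)
  proof (induction rule: time_scale_induct)
    case base
    then show ?case by simp
  next
    case (scattered t)
    have "g a - e * (fwd_jump S t - a) \<le> g a - e * (t - a)"
      using e scattered.hyps(4) by (simp add: mult_left_mono)
    also have "\<dots> \<le> g t" using scattered.hyps by (simp add: scattered.IH)
    also have "\<dots> \<le> g (fwd_jump S t)" using assms(6) scattered.hyps by simp
    finally show ?case .
  next
    case (right_dense t)
    obtain D where "D \<ge> 0" "(g has_real_derivative D) (at t within S)"
      using dense right_dense.hyps by blast
    then have "(g has_derivative (*) D) (at t within S)" by (simp add: has_field_derivative_def)
    then obtain d where d: "d > 0" "\<And>r. r \<in> S \<Longrightarrow> norm (r - t) < d \<Longrightarrow>
          norm (g r - g t - D * (r - t)) \<le> e * norm (r - t)"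
      using e unfolding has_derivative_within_alt by metis
    have "g a - e * (r - a) \<le> g r" if "r \<in> S" "t < r" "dist r t < d" for r
    proof -
      have "\<bar>g r - g t - D * (r - t)\<bar> \<le> e * (r - t)" using d(2)[of r] that by (simp add: dist_real_def)
      moreover have "D * (r - t) \<ge> 0" using \<open>D \<ge> 0\<close> that by simp
      moreover have "g a - e * (t - a) \<le> g t" using right_dense by simp
      ultimately show ?thesis by (simp add: algebra_simps)
    qed
    then show ?case using d(1) by (auto simp: eventually_at)
  next
    case (left_dense t)
    show ?case
    proof (rule ccontr)
      assume "\<not> ?case"
      then have "g t < g a - e * (t - a)" by simp
      then obtain d where d: "d > 0" "\<And>r. r \<in> S \<Longrightarrow> dist r t < d \<Longrightarrow> dist (g r) (g t) < g a - e * (t - a) - g t"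
        using cont[of t] left_dense.hyps unfolding continuous_within_eps_delta
        by (metis diff_gt_0_iff_gt less_imp_le)
      obtain r where r: "r \<in> S" "max a (t - d) < r" "r < t"
        using left_dense.hyps d(1) by (auto simp: left_dense_iff dest: spec[of _ "max a (t - d)"])
      have "g r < g a - e * (t - a)" using d(2)[of r] r by (auto simp: dist_real_def)
      also have "\<dots> \<le> g a - e * (r - a)" using r e by (simp add: mult_left_mono)
      also have "\<dots> \<le> g r" using left_dense.IH[of r] r by simp
      finally show False by simp
    qed
  qed
  moreover have "e * (b - a) \<le> e0" using \<open>e0 > 0\<close> \<open>a \<le> b\<close> by (simp add: e_def field_simps)
  ultimately show "g a \<le> g b + e0" by simp
qed

text \<open>Monotonicity of the integral, phrased for antiderivatives. It carries all integral
  estimates of the main proof and, used in both directions, the uniqueness of antiderivatives up to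
  a constant.\<close>

lemma delta_derivative_mono:
  assumes "closed S" "a \<in> S" "b \<in> S" "a \<le> b"
    and F: "\<And>t. t \<in> S \<Longrightarrow> a \<le> t \<Longrightarrow> t \<le> b \<Longrightarrow> has_delta_derivative S F (f t) t"
    and G: "\<And>t. t \<in> S \<Longrightarrow> a \<le> t \<Longrightarrow> t \<le> b \<Longrightarrow> has_delta_derivative S G (g t) t"
    and le: "\<And>t. t \<in> S \<Longrightarrow> a \<le> t \<Longrightarrow> t \<le> b \<Longrightarrow> f t \<le> g t"
  shows "F b - F a \<le> G b - G a"
proof -
  have "(\<lambda>t. G t - F t) a \<le> (\<lambda>t. G t - F t) b"
    using assms(1-4)
  proof (rule time_scale_mono)
    fix t assume t: "t \<in> S" "a \<le> t" "t \<le> b"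
    show "continuous (at t within S) (\<lambda>t. G t - F t)"
      using F[OF t] G[OF t] t by (intro continuous_intros) (auto simp: has_delta_derivative_iff)
  next
    fix t assume t: "t \<in> S" "a \<le> t" "t < b"
    have "graininess S t * f t \<le> graininess S t * g t"
      using le[of t] t by (intro mult_left_mono graininess_nonneg) auto
    then show "G t - F t \<le> G (fwd_jump S t) - F (fwd_jump S t)"
      using F[of t] G[of t] t by (auto simp: has_delta_derivative_iff)
    assume "fwd_jump S t = t"
    then show "\<exists>D\<ge>0. ((\<lambda>t. G t - F t) has_real_derivative D) (at t within S)"
      using F[of t] G[of t] le[of t] t
      by (intro exI[of _ "g t - f t"] conjI DERIV_diff) (auto simp: has_delta_derivative_iff)
  qed
  then show ?thesis by simp
qed

text \<open>Justifies the definite description: two antiderivatives of the same function have equal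
  increments, by comparison in both directions.\<close>

lemma delta_integral_eq:
  assumes "closed S" "s \<in> S" "t \<in> S"
    and F: "\<And>u. u \<in> S \<Longrightarrow> has_delta_derivative S F (f u) u"
  shows "delta_integral S f s t = F t - F s"
  unfolding delta_integral_def
proof (rule the_equality)
  show "\<exists>Fa. (\<forall>u\<in>S. has_delta_derivative S Fa (f u) u) \<and> F t - F s = Fa t - Fa s"
    using F by blast
next
  fix I assume "\<exists>F. (\<forall>u\<in>S. has_delta_derivative S F (f u) u) \<and> I = F t - F s"
  then obtain G where G: "\<And>u. u \<in> S \<Longrightarrow> has_delta_derivative S G (f u) u" "I = G t - G s" by blast
  have "F b - F a = G b - G a" if "a \<in> S" "b \<in> S" "a \<le> b" for a b
    using delta_derivative_mono[OF assms(1) that, of F f G f]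
      delta_derivative_mono[OF assms(1) that, of G f F f] F G(1) by force
  from this[of s t] this[of t s] show "I = F t - F s" using assms G(2) by force
qed

text \<open>For c = 1 and c = -1 the function \<open>u c\<close> = v + c x satisfies u^\<Delta>
  \<ge> -A u. At a scattered point this preserves positivity because 1 - \<mu> A > 0, and at a
  right-dense point positivity spreads by continuity. In \<open>step\<close> the bound may be used
  on all of [a, t], so x' may depend on delayed values of x.\<close>

lemma delta_comparison:
  assumes "closed S" "a \<in> S" "b \<in> S" "a \<le> b"
    and x: "\<And>t. t \<in> S \<Longrightarrow> a \<le> t \<Longrightarrow> has_delta_derivative S x (x' t) t"
    and v: "\<And>t. t \<in> S \<Longrightarrow> a \<le> t \<Longrightarrow> has_delta_derivative S v (v' t) t"
    and E: "\<And>t. t \<in> S \<Longrightarrow> a \<le> t \<Longrightarrow> has_delta_derivative S E (- A t * E t) t"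
    and E_pos: "\<And>t. t \<in> S \<Longrightarrow> a \<le> t \<Longrightarrow> 0 < E t"
    and reg: "\<And>t. t \<in> S \<Longrightarrow> a \<le> t \<Longrightarrow> graininess S t * A t < 1"
    and init: "\<bar>x a\<bar> < v a"
    and step: "\<And>t. t \<in> S \<Longrightarrow> a \<le> t \<Longrightarrow> (\<And>r. r \<in> S \<Longrightarrow> a \<le> r \<Longrightarrow> r \<le> t \<Longrightarrow> \<bar>x r\<bar> < v r) \<Longrightarrow>
                \<bar>x' t + A t * x t\<bar> \<le> v' t + A t * v t"
  shows "\<bar>x b\<bar> < v b"
proof -
  define u where "u c t = v t + c * x t" for c t :: real
  have u_cont: "continuous (at t within S) (u c)" if "t \<in> S" "a \<le> t" for c t
    using x[OF that] v[OF that] that unfolding u_def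
    by (intro continuous_intros) (auto simp: has_delta_derivative_iff)
  have u_iff: "\<bar>x t\<bar> < v t \<longleftrightarrow> 0 < u 1 t \<and> 0 < u (-1) t" for t by (auto simp: u_def)
  show ?thesis using assms(1-4)
  proof (induction rule: time_scale_induct)
    case base
    show ?case by fact
  next
    case (scattered t)
    let ?\<mu> = "graininess S t"
    have st: "\<bar>x' t + A t * x t\<bar> \<le> v' t + A t * v t"
      using step scattered by blast
    have "0 < u c (fwd_jump S t)" if c: "c = 1 \<or> c = -1" for c
    proof -
      have "- (A t * u c t) \<le> v' t + c * x' t" using st c by (auto simp: u_def abs_le_iff algebra_simps)
      then have "?\<mu> * - (A t * u c t) \<le> ?\<mu> * (v' t + c * x' t)"
        by (intro mult_left_mono graininess_nonneg)
      moreover have "0 < (1 - ?\<mu> * A t) * u c t"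
        using reg[of t] scattered u_iff[of t] c by (intro mult_pos_pos) auto
      moreover have "u c (fwd_jump S t) = u c t + ?\<mu> * (v' t + c * x' t)"
        using x[of t] v[of t] scattered.hyps by (simp add: u_def has_delta_derivative_iff algebra_simps)
      ultimately show ?thesis by (simp add: algebra_simps)
    qed
    then show ?case unfolding u_iff by auto
  next
    case (right_dense t)
    have "\<forall>\<^sub>F r in at t within S \<inter> {t<..}. 0 < u c r" if "c = 1 \<or> c = -1" for c
    proof -
      have "(u c \<longlongrightarrow> u c t) (at t within S)"
        using u_cont[of t c] right_dense.hyps by (simp add: continuous_within)
      moreover have "0 < u c t" using right_dense u_iff[of t] that by auto
      ultimately have "\<forall>\<^sub>F r in at t within S. 0 < u c r" by (rule order_tendstoD(1))
      then show ?thesis by (rule filter_leD[OF at_le, rotated]) auto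
    qed
    from this[of 1] this[of "-1"] show ?case unfolding u_iff by (simp add: eventually_conj_iff)
  next
    case (left_dense t)
    have "0 < u c t" if c: "c = 1 \<or> c = -1" for c
    proof -
      \<comment> \<open>The limit from the left would only give \<open>u c t \<ge> 0\<close>. The
        nondecreasing quotient compares with time \<open>a\<close> instead and keeps the inequality
        strict.\<close>
      have "u c a / E a \<le> u c t / E t"
      proof (rule time_scale_mono[where g = "\<lambda>r. u c r / E r" and S = S])
        fix r assume r: "r \<in> S" "a \<le> r" "r \<le> t"
        show "continuous (at r within S) (\<lambda>r. u c r / E r)"
          using u_cont[of r c] E[of r] E_pos[of r] r
          by (intro continuous_at_within_divide) (auto simp: has_delta_derivative_iff)
      next
        fix r assume r: "r \<in> S" "a \<le> r" "r < t"
        let ?\<mu> = "graininess S r"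
        have st: "\<bar>x' r + A r * x r\<bar> \<le> v' r + A r * v r"
          using step[of r] left_dense.IH r by force
        have up: "- (A r * u c r) \<le> v' r + c * x' r" using st c by (auto simp: u_def abs_le_iff algebra_simps)
        {
          have "?\<mu> * - (A r * u c r) \<le> ?\<mu> * (v' r + c * x' r)"
            using up by (intro mult_left_mono graininess_nonneg)
          moreover have "u c (fwd_jump S r) = u c r + ?\<mu> * (v' r + c * x' r)"
            using x[of r] v[of r] r by (simp add: u_def has_delta_derivative_iff algebra_simps)
          ultimately have 1: "u c r * (1 - ?\<mu> * A r) \<le> u c (fwd_jump S r)" by (simp add: algebra_simps)
          have 2: "E (fwd_jump S r) = E r * (1 - ?\<mu> * A r)"
            using E[of r] r by (simp add: has_delta_derivative_iff algebra_simps)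
          have 3: "0 < E r" "0 < 1 - ?\<mu> * A r" using E_pos reg[of r] r by auto
          have "u c r / E r = u c r * (1 - ?\<mu> * A r) / E (fwd_jump S r)"
            unfolding 2 using 3 by simp
          also have "\<dots> \<le> u c (fwd_jump S r) / E (fwd_jump S r)"
            using 1 2 3 by (intro divide_right_mono) auto
          finally show "u c r / E r \<le> u c (fwd_jump S r) / E (fwd_jump S r)" .
        }
        assume d: "fwd_jump S r = r"
        have "(u c has_real_derivative v' r + c * x' r) (at r within S)"
          unfolding u_def using x[of r] v[of r] r d
          by (auto intro!: derivative_eq_intros simp: has_delta_derivative_iff)
        moreover have "(E has_real_derivative - A r * E r) (at r within S)"
          using E[of r] r d by (auto simp: has_delta_derivative_iff)
        ultimately have "((\<lambda>r. u c r / E r) has_real_derivative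
            ((v' r + c * x' r) * E r - u c r * (- A r * E r)) / (E r * E r)) (at r within S)"
          using E_pos[of r] r by (intro DERIV_divide) auto
        moreover have "0 \<le> (v' r + c * x' r + A r * u c r) * E r"
          using up E_pos[of r] r by (intro mult_nonneg_nonneg) auto
        then have "0 \<le> ((v' r + c * x' r) * E r - u c r * (- A r * E r)) / (E r * E r)"
          by (intro divide_nonneg_nonneg) (auto simp: algebra_simps)
        ultimately show "\<exists>D\<ge>0. ((\<lambda>r. u c r / E r) has_real_derivative D) (at r within S)" by blast
      qed (use assms left_dense.hyps in auto)
      moreover have "0 < u c a / E a" using init u_iff[of a] c E_pos[of a] assms(2) by auto
      ultimately have "0 < u c t / E t" by simp
      then show ?thesis using E_pos[of t] left_dense.hyps by (simp add: zero_less_divide_iff)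
    qed
    then show ?case unfolding u_iff by auto
  qed
qed

subsection \<open>Rd-continuity and antiderivatives\<close>

lemma right_scattered_gap:
  assumes "t \<in> S" "\<not> right_dense S t"
  obtains d where "d > 0" "\<And>r. r \<in> S \<Longrightarrow> t < r \<Longrightarrow> t + d \<le> r"
proof (cases "S \<inter> {t<..} = {}")
  case True
  show ?thesis by (rule that[of 1]) (use True in auto)
next
  case False
  then have "t < fwd_jump S t" using assms fwd_jump_ge[of t S] by (auto simp: right_dense_iff)
  show ?thesis
    by (rule that[of "fwd_jump S t - t"]) (use \<open>t < fwd_jump S t\<close> fwd_jump_le in force)+
qed

lemma rd_continuous_right:
  assumes "rd_continuous S f" "t \<in> S" "e > 0"
  obtains d where "d > 0" "\<And>r. r \<in> S \<Longrightarrow> t \<le> r \<Longrightarrow> r < t + d \<Longrightarrow> \<bar>f r - f t\<bar> < e"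
proof (cases "right_dense S t")
  case True
  then have "continuous (at t within S) f" using assms by (simp add: rd_continuous_def)
  then obtain d where "d > 0" "\<And>r. r \<in> S \<Longrightarrow> dist r t < d \<Longrightarrow> dist (f r) (f t) < e"
    using assms(3) unfolding continuous_within_eps_delta by metis
  then show ?thesis by (intro that[of d]) (auto simp: dist_real_def)
next
  case False
  then obtain d where d: "d > 0" "\<And>r. r \<in> S \<Longrightarrow> t < r \<Longrightarrow> t + d \<le> r"
    using right_scattered_gap assms(2) by metis
  have "r = t" if "r \<in> S" "t \<le> r" "r < t + d" for r using d(2)[of r] that by linarith
  then show ?thesis using d(1) assms(3) that[of d] by force
qed

text \<open>One formulation for all points: if \<open>t\<close> is not left-dense, no point of
  \<open>S\<close> lies just before \<open>t\<close> and the condition holds vacuously with limit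
  0.\<close>

lemma rd_continuous_left:
  assumes "rd_continuous S f" "t \<in> S"
  obtains L where "\<And>e. e > 0 \<Longrightarrow> \<exists>d>0. \<forall>r\<in>S. t - d < r \<longrightarrow> r < t \<longrightarrow> \<bar>f r - L\<bar> < e"
proof (cases "left_dense S t")
  case True
  then obtain L where L: "(f \<longlongrightarrow> L) (at t within (S \<inter> {..<t}))"
    using assms by (auto simp: rd_continuous_def)
  have "\<exists>d>0. \<forall>r\<in>S. t - d < r \<longrightarrow> r < t \<longrightarrow> \<bar>f r - L\<bar> < e" if "e > 0" for e
  proof -
    obtain d where "d > 0" "\<And>r. r \<in> S \<inter> {..<t} \<Longrightarrow> r \<noteq> t \<Longrightarrow> dist r t < d \<Longrightarrow> dist (f r) L < e"
      using tendstoD[OF L \<open>e > 0\<close>] unfolding eventually_at by metis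
    then show ?thesis by (intro exI[of _ d]) (auto simp: dist_real_def)
  qed
  then show ?thesis by (rule that)
next
  case False
  then obtain d where d: "d < t" "\<And>r. r \<in> S \<Longrightarrow> r < t \<Longrightarrow> r \<le> d"
    using assms(2) by (force simp: left_dense_iff)
  have "\<exists>d>0. \<forall>r\<in>S. t - d < r \<longrightarrow> r < t \<longrightarrow> \<bar>f r - 0\<bar> < e" for e
    using d by (intro exI[of _ "t - d"]) force
  then show ?thesis by (rule that)
qed

text \<open>Bisection instead of compactness of the image, as \<open>f\<close> may jump at
  left-dense points. Near a point of \<open>S\<close>, right continuity and the left limit give a
  local bound; a point outside the closed set \<open>S\<close> has a neighbourhood free of
  \<open>S\<close>.\<close>

lemma rd_continuous_bounded:
  assumes "closed S" "rd_continuous S f"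
  shows "\<exists>B. \<forall>r\<in>S. a \<le> r \<longrightarrow> r \<le> b \<longrightarrow> \<bar>f r\<bar> \<le> B"
proof (cases "a \<le> b")
  case True
  then show ?thesis
  proof (induction rule: Bolzano)
    case (trans a b c)
    then obtain B C where "\<forall>r\<in>S. a \<le> r \<longrightarrow> r \<le> b \<longrightarrow> \<bar>f r\<bar> \<le> B" "\<forall>r\<in>S. b \<le> r \<longrightarrow> r \<le> c \<longrightarrow> \<bar>f r\<bar> \<le> C"
      by metis
    then have "\<forall>r\<in>S. a \<le> r \<longrightarrow> r \<le> c \<longrightarrow> \<bar>f r\<bar> \<le> max B C" by (metis le_cases max.coboundedI1 max.coboundedI2)
    then show ?case ..
  next
    case (local q)
    show ?case
    proof (cases "q \<in> S")
      case True
      obtain d1 where d1: "d1 > 0" "\<And>r. r \<in> S \<Longrightarrow> q \<le> r \<Longrightarrow> r < q + d1 \<Longrightarrow> \<bar>f r - f q\<bar> < 1"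
        using rd_continuous_right[OF assms(2) True, of 1] by auto
      obtain L where "\<And>e. e > 0 \<Longrightarrow> \<exists>d>0. \<forall>r\<in>S. q - d < r \<longrightarrow> r < q \<longrightarrow> \<bar>f r - L\<bar> < e"
        using rd_continuous_left[OF assms(2) True] by metis
      from this[of 1] obtain d2 where d2: "d2 > 0" "\<forall>r\<in>S. q - d2 < r \<longrightarrow> r < q \<longrightarrow> \<bar>f r - L\<bar> < 1" by auto
      have "\<bar>f r\<bar> \<le> \<bar>f q\<bar> + \<bar>L\<bar> + 1" if "r \<in> S" "q - d2 < r" "r < q + d1" for r
      proof (cases "q \<le> r")
        case True
        then show ?thesis using d1(2)[of r] that by linarith
      next
        case False
        then have "\<bar>f r - L\<bar> < 1" using d2 that by simp
        then show ?thesis by linarith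
      qed
      then have "\<exists>B. \<forall>r\<in>S. a \<le> r \<longrightarrow> r \<le> b \<longrightarrow> \<bar>f r\<bar> \<le> B" if "a \<le> q" "q \<le> b" "b - a < min d1 d2" for a b
        using that by (intro exI[of _ "\<bar>f q\<bar> + \<bar>L\<bar> + 1"]) auto
      then show ?thesis using d1(1) d2(1) by (intro exI[of _ "min d1 d2"]) auto
    next
      case False
      then obtain d where d: "d > 0" "ball q d \<subseteq> - S"
        using assms(1) open_contains_ball[of "- S"] by auto
      have "r \<notin> S" if "a \<le> q" "q \<le> b" "b - a < d" "a \<le> r" "r \<le> b" for a b r
        using d(2) that by (auto simp: dist_real_def subset_iff)
      then show ?thesis using d(1) by (intro exI[of _ d]) auto
    qed
  qed
qed auto

section \<open>Graininess near dense points and operations that preserve rd-continuity\<close>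

lemma graininess_tendsto_right_dense:
  assumes "right_dense S t"
  shows "(graininess S \<longlongrightarrow> 0) (at t within S)"
proof (rule tendstoI)
  fix e :: real assume e: "e > 0"
  obtain q where q: "q \<in> S" "t < q" "q < t + e"
    using assms fwd_jump_dense[of S t _ "t + e"] e by (auto simp: right_dense_iff)
  have "dist (graininess S r) 0 < e" if "r \<in> S" "r \<noteq> t" "dist r t < min e (q - t)" for r
  proof (cases "r < t")
    case True
    then have "fwd_jump S r \<le> t" using assms by (intro fwd_jump_le) (auto simp: right_dense_iff)
    then show ?thesis using that True graininess_nonneg[of S r] by (auto simp: graininess_def dist_real_def)
  next
    case False
    then have "fwd_jump S r \<le> q" using q that by (intro fwd_jump_le) (auto simp: dist_real_def)
    then show ?thesis using that False q graininess_nonneg[of S r] by (auto simp: graininess_def dist_real_def)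
  qed
  then show "\<forall>\<^sub>F r in at t within S. dist (graininess S r) 0 < e"
    unfolding eventually_at using e q by (intro exI[of _ "min e (q - t)"]) auto
qed

lemma graininess_tendsto_left:
  assumes "t \<in> S"
  shows "(graininess S \<longlongrightarrow> 0) (at t within (S \<inter> {..<t}))"
proof (rule tendstoI)
  fix e :: real assume e: "e > 0"
  have "dist (graininess S r) 0 < e" if "r \<in> S \<inter> {..<t}" "dist r t < e" for r
  proof -
    have "fwd_jump S r \<le> t" using assms that by (intro fwd_jump_le) auto
    then show ?thesis using that graininess_nonneg[of S r] by (auto simp: graininess_def dist_real_def)
  qed
  then show "\<forall>\<^sub>F r in at t within (S \<inter> {..<t}). dist (graininess S r) 0 < e"
    unfolding eventually_at using e by (intro exI[of _ e]) auto
qed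

text \<open>The graininess itself is discontinuous, but it tends to 0 at exactly the points that
  rd-continuity tests: fully at right-dense points, from the left at left-dense ones. Hence \<Phi>
  need only behave well as its first argument tends to 0.\<close>

lemma rd_continuous_graininess_comp:
  assumes f: "rd_continuous S f"
    and \<Phi>: "\<And>F h z L. (h \<longlongrightarrow> 0) F \<Longrightarrow> (z \<longlongrightarrow> L) F \<Longrightarrow> ((\<lambda>r::real. \<Phi> (h r) (z r)) \<longlongrightarrow> \<Phi> 0 L) F"
  shows "rd_continuous S (\<lambda>t. \<Phi> (graininess S t) (f t))"
  unfolding rd_continuous_def
proof (intro conjI ballI impI)
  fix t assume t: "t \<in> S" "right_dense S t"
  then have "(f \<longlongrightarrow> f t) (at t within S)" using f by (auto simp: rd_continuous_def continuous_within)
  from \<Phi>[OF graininess_tendsto_right_dense[OF t(2)] this]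
  show "continuous (at t within S) (\<lambda>t. \<Phi> (graininess S t) (f t))"
    using t(2) by (simp add: continuous_within right_dense_def)
next
  fix t assume t: "t \<in> S" "left_dense S t"
  then obtain L where "(f \<longlongrightarrow> L) (at t within (S \<inter> {..<t}))" using f by (auto simp: rd_continuous_def)
  from \<Phi>[OF graininess_tendsto_left[OF t(1)] this]
  show "\<exists>L. ((\<lambda>t. \<Phi> (graininess S t) (f t)) \<longlongrightarrow> L) (at t within (S \<inter> {..<t}))" ..
qed

lemma rd_continuous_mult:
  assumes "rd_continuous S f" "rd_continuous S g"
  shows "rd_continuous S (\<lambda>t. f t * g t)"
  unfolding rd_continuous_def
proof (intro conjI ballI impI)
  fix t assume "t \<in> S" "right_dense S t"
  then show "continuous (at t within S) (\<lambda>t. f t * g t)"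
    using assms by (intro continuous_mult) (auto simp: rd_continuous_def)
next
  fix t assume t: "t \<in> S" "left_dense S t"
  then obtain L M where "(f \<longlongrightarrow> L) (at t within (S \<inter> {..<t}))" "(g \<longlongrightarrow> M) (at t within (S \<inter> {..<t}))"
    using assms by (meson rd_continuous_def)
  then show "\<exists>L. ((\<lambda>t. f t * g t) \<longlongrightarrow> L) (at t within (S \<inter> {..<t}))"
    by (blast intro: tendsto_mult)
qed

text \<open>From |ln(1 + y) - y| \<le> 2 y^2 for |y| \<le> 1/2, with y = h z, division by |h| shows
  that the cylinder transformation differs from z by at most 2 |h| z^2.\<close>

lemma tendsto_cylinder:
  assumes h: "(h \<longlongrightarrow> 0) F" and z: "(z \<longlongrightarrow> L) F"
  shows "((\<lambda>r. cylinder (h r) (z r)) \<longlongrightarrow> cylinder 0 L) F"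
proof -
  have "((\<lambda>r. \<bar>h r * z r\<bar>) \<longlongrightarrow> 0) F" using tendsto_mult[OF h z] by (simp add: tendsto_rabs_zero_iff)
  then have "\<forall>\<^sub>F r in F. \<bar>h r * z r\<bar> < 1 / 2" by (rule order_tendstoD) simp
  then have "\<forall>\<^sub>F r in F. norm (cylinder (h r) (z r) - z r) \<le> 2 * \<bar>h r\<bar> * (z r)\<^sup>2"
  proof eventually_elim
    case (elim r)
    show ?case
    proof (cases "h r = 0")
      case False
      have "\<bar>ln (1 + h r * z r) - h r * z r\<bar> \<le> 2 * (h r * z r)\<^sup>2"
        using abs_ln_one_plus_x_minus_x_bound[of "h r * z r"] elim by simp
      then have "\<bar>ln (1 + h r * z r) - h r * z r\<bar> / \<bar>h r\<bar> \<le> 2 * (h r * z r)\<^sup>2 / \<bar>h r\<bar>"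
        by (rule divide_right_mono) simp
      also have "\<dots> = 2 * \<bar>h r\<bar> * (z r)\<^sup>2"
        using False by (simp add: power2_eq_square field_simps)
      also have "\<bar>ln (1 + h r * z r) - h r * z r\<bar> / \<bar>h r\<bar> = \<bar>cylinder (h r) (z r) - z r\<bar>"
        using False by (simp add: cylinder_def abs_divide[symmetric] diff_divide_distrib)
      finally show ?thesis by simp
    qed (simp add: cylinder_def)
  qed
  moreover have "((\<lambda>r. 2 * \<bar>h r\<bar> * (z r)\<^sup>2) \<longlongrightarrow> 2 * \<bar>0\<bar> * L\<^sup>2) F"
    by (intro tendsto_intros h z)
  then have "((\<lambda>r. 2 * \<bar>h r\<bar> * (z r)\<^sup>2) \<longlongrightarrow> 0) F" by simp
  ultimately have "((\<lambda>r. cylinder (h r) (z r) - z r) \<longlongrightarrow> 0) F" by (rule Lim_null_comparison)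
  from tendsto_add[OF this z] show ?thesis by (simp add: cylinder_def)
qed

lemma rd_continuous_cylinder:
  "rd_continuous S f \<Longrightarrow> rd_continuous S (\<lambda>t. cylinder (graininess S t) (f t))"
  by (erule rd_continuous_graininess_comp[where \<Phi> = cylinder]) (rule tendsto_cylinder)

lemma rd_continuous_circle_minus: "rd_continuous S f \<Longrightarrow> rd_continuous S (circle_minus S f)"
  unfolding circle_minus_def[abs_def]
proof (rule rd_continuous_graininess_comp[where \<Phi> = "\<lambda>h z. - z / (1 + h * z)"])
  fix F and h z :: "real \<Rightarrow> real" and L assume "(h \<longlongrightarrow> 0) F" "(z \<longlongrightarrow> L) F"
  then show "((\<lambda>r. - z r / (1 + h r * z r)) \<longlongrightarrow> - L / (1 + 0 * L)) F"
    by (intro tendsto_intros) auto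
qed

lemma rd_continuous_cmult: "rd_continuous S f \<Longrightarrow> rd_continuous S (\<lambda>t. c * f t)"
  by (rule rd_continuous_graininess_comp[where \<Phi> = "\<lambda>h z. c * z"]) (auto intro: tendsto_intros)

section \<open>Delta antiderivatives from the ordinary integral\<close>

lemma regulated_integrable_on:
  fixes h :: "real \<Rightarrow> real"
  assumes R: "\<And>q. \<exists>l. (h \<longlongrightarrow> l) (at_right q)" and L: "\<And>q. \<exists>l. (h \<longlongrightarrow> l) (at_left q)"
  shows "h integrable_on {a..b}"
proof (cases "a \<le> b")
  case True
  \<comment> \<open>Uniform approximation by step functions, assembled by bisection. Near a point q
    the step function takes the left limit, the value at q and the right limit.\<close>
  have "\<exists>g. (\<forall>x\<in>{a..b}. norm (h x - g x) \<le> e) \<and> g integrable_on {a..b}" if e: "e > 0" for e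
    using True
  proof (induction rule: Bolzano)
    case (trans a b c)
    then obtain g1 g2 where g: "\<forall>x\<in>{a..b}. norm (h x - g1 x) \<le> e" "g1 integrable_on {a..b}"
      "\<forall>x\<in>{b..c}. norm (h x - g2 x) \<le> e" "g2 integrable_on {b..c}" by metis
    define g where "g x = (if x \<le> b then g1 x else g2 x)" for x
    have "g integrable_on {a..b}"
      by (rule integrable_eq[OF g(2)]) (simp add: g_def)
    moreover have "g integrable_on {b..c}"
      by (rule integrable_spike_finite[where S = "{b}", OF _ _ g(4)]) (auto simp: g_def)
    ultimately have "g integrable_on {a..c}"
      by (rule Henstock_Kurzweil_Integration.integrable_combine[OF trans.hyps])
    moreover have "\<forall>x\<in>{a..c}. norm (h x - g x) \<le> e" using g(1,3) by (auto simp: g_def)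
    ultimately show ?case by metis
  next
    case (local q)
    obtain r l where rl: "(h \<longlongrightarrow> r) (at_right q)" "(h \<longlongrightarrow> l) (at_left q)" using R L by metis
    obtain d1 where d1: "d1 > 0" "\<And>x. q < x \<Longrightarrow> x < q + d1 \<Longrightarrow> \<bar>h x - r\<bar> < e"
      using tendstoD[OF rl(1) e] unfolding eventually_at_right_field
      by (metis add.commute diff_gt_0_iff_gt diff_add_cancel dist_real_def)
    obtain d2 where d2: "d2 > 0" "\<And>x. q - d2 < x \<Longrightarrow> x < q \<Longrightarrow> \<bar>h x - l\<bar> < e"
      using tendstoD[OF rl(2) e] unfolding eventually_at_left_field
      by (metis diff_gt_0_iff_gt diff_diff_eq2 add_diff_cancel_left' dist_real_def)
    define g where "g x = (if x < q then l else if x = q then h q else r)" for x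
    have "\<exists>g. (\<forall>x\<in>{a..b}. norm (h x - g x) \<le> e) \<and> g integrable_on {a..b}"
      if ab: "a \<le> q" "q \<le> b" "b - a < min d1 d2" for a b
    proof (intro exI conjI ballI)
      fix x assume "x \<in> {a..b}"
      then show "norm (h x - g x) \<le> e"
        using d1(2)[of x] d2(2)[of x] ab e by (auto simp: g_def)
    next
      have "g integrable_on {a..q}"
        by (rule integrable_spike_finite[where S = "{q}" and f = "\<lambda>_. l"]) (auto simp: g_def)
      moreover have "g integrable_on {q..b}"
        by (rule integrable_spike_finite[where S = "{q}" and f = "\<lambda>_. r"]) (auto simp: g_def)
      ultimately show "g integrable_on {a..b}"
        by (rule Henstock_Kurzweil_Integration.integrable_combine[OF ab(1,2)])
    qed
    then show ?case using d1(1) d2(1) by (intro exI[of _ "min d1 d2"]) auto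
  qed
  then show ?thesis using integrable_uniform_limit[of a b h] by (simp add: cbox_interval)
qed (simp add: integrable_on_empty)

text \<open>
  For rd-continuous \<open>f\<close> the real function \<open>f \<circ> floor\<close> is regulated, and its ordinary
  indefinite integral restricts to a delta antiderivative of \<open>f\<close>.  Inserting \<open>a = min S\<close> keeps
  the floor in \<open>S\<close> to the left of \<open>a\<close>.
\<close>

definition time_scale_floor :: "real set \<Rightarrow> real \<Rightarrow> real \<Rightarrow> real" where
  "time_scale_floor S a r = Sup (insert a (S \<inter> {..r}))"

context
  fixes S :: "real set" and a :: real
  assumes S: "closed S" "a \<in> S" "S \<subseteq> {a..}"
begin

private lemma floor_bdd: "bdd_above (insert a (S \<inter> {..r}))"
  by (auto intro!: bdd_aboveI[of _ "max a r"])

lemma time_scale_floor_mem: "time_scale_floor S a r \<in> S"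
  unfolding time_scale_floor_def
  by (rule closed_subset_contains_Sup[OF S(1) _ _ floor_bdd]) (use S in auto)

lemma time_scale_floor_le: "a \<le> r \<Longrightarrow> time_scale_floor S a r \<le> r"
  unfolding time_scale_floor_def by (rule cSup_least) auto

lemma time_scale_floor_ge: "q \<in> S \<Longrightarrow> q \<le> r \<Longrightarrow> q \<le> time_scale_floor S a r"
  unfolding time_scale_floor_def by (rule cSup_upper[OF _ floor_bdd]) auto

lemma time_scale_floor_eqI:
  assumes "q \<in> S" "q \<le> r" "\<And>p. p \<in> S \<Longrightarrow> p \<le> r \<Longrightarrow> p \<le> q"
  shows "time_scale_floor S a r = q"
proof (rule antisym)
  show "time_scale_floor S a r \<le> q"
    using assms S by (intro assms(3) time_scale_floor_mem time_scale_floor_le) auto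
qed (rule time_scale_floor_ge[OF assms(1,2)])

lemma time_scale_floor_below: "r < a \<Longrightarrow> time_scale_floor S a r = a"
proof -
  assume "r < a"
  then have "S \<inter> {..r} = {}" using S(3) by auto
  then show ?thesis by (simp add: time_scale_floor_def)
qed

text \<open>If q is in \<open>S\<close>, floors of points just right of q lie in \<open>S\<close>
  just right of q or equal q, and \<open>f\<close> is right continuous there. If q lies in a gap,
  the floor is constant just after q.\<close>

lemma rd_continuous_floor_right:
  assumes f: "rd_continuous S f"
  shows "((\<lambda>r. f (time_scale_floor S a r)) \<longlongrightarrow> f (time_scale_floor S a q)) (at_right q)"
proof (cases "q < a")
  case True
  have "\<forall>\<^sub>F r in at_right q. r < a" by (rule order_tendstoD(2)[OF tendsto_ident_at True])
  then have "\<forall>\<^sub>F r in at_right q. f (time_scale_floor S a r) = f (time_scale_floor S a q)"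
    by eventually_elim (use True in \<open>simp add: time_scale_floor_below\<close>)
  then show ?thesis by (rule tendsto_eventually)
next
  case False
  define c where "c = time_scale_floor S a q"
  have c: "c \<in> S" "c \<le> q" using False by (auto simp: c_def time_scale_floor_mem time_scale_floor_le)
  show ?thesis
  proof (rule tendstoI)
    fix e :: real assume "e > 0"
    obtain d where d: "d > 0" "\<And>r. r \<in> S \<Longrightarrow> c \<le> r \<Longrightarrow> r < c + d \<Longrightarrow> \<bar>f r - f c\<bar> < e"
      using rd_continuous_right[OF f c(1) \<open>e > 0\<close>] by metis
    obtain b where b: "b > q" "\<And>r. r \<in> S \<Longrightarrow> q < r \<Longrightarrow> r < b \<Longrightarrow> r < c + d"
    proof (cases "c = q")
      case True
      then show ?thesis using d(1) by (intro that[of "c + d"]) auto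
    next
      case False
      then have "q \<notin> S" using time_scale_floor_ge[of q q] c by (auto simp: c_def)
      then obtain k where k: "k > 0" "ball q k \<subseteq> - S"
        using S(1) open_contains_ball[of "- S"] by auto
      then have "r \<notin> S" if "q < r" "r < q + k" for r using that by (auto simp: dist_real_def subset_iff)
      then show ?thesis using k(1) by (intro that[of "q + k"]) auto
    qed
    have "dist (f (time_scale_floor S a r)) (f (time_scale_floor S a q)) < e" if "q < r" "r < b" for r
    proof -
      let ?p = "time_scale_floor S a r"
      have p: "?p \<in> S" "?p \<le> r" "c \<le> ?p"
        using False that c by (auto intro: time_scale_floor_mem time_scale_floor_le time_scale_floor_ge)
      have "?p < c + d"
      proof (cases "q < ?p")
        case True
        then show ?thesis using b(2)[of ?p] p that by auto
      next
        case False
        then have "?p \<le> c" unfolding c_def using p by (intro time_scale_floor_ge) auto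
        then show ?thesis using d(1) by simp
      qed
      then show ?thesis using d(2)[OF p(1,3)] by (simp add: dist_real_def c_def)
    qed
    then show "\<forall>\<^sub>F r in at_right q. dist (f (time_scale_floor S a r)) (f (time_scale_floor S a q)) < e"
      unfolding eventually_at_right_field using b(1) by metis
  qed
qed

text \<open>Before \<open>a\<close> the floor is constant, and likewise at the end of a gap.
  Otherwise points of \<open>S\<close> accumulate at q from the left, so q belongs to
  \<open>S\<close> and the left limit of \<open>f\<close> at q is available.\<close>

lemma rd_continuous_floor_left:
  assumes f: "rd_continuous S f"
  shows "\<exists>L. ((\<lambda>r. f (time_scale_floor S a r)) \<longlongrightarrow> L) (at_left q)"
proof (cases "q \<le> a")
  case True
  have "\<forall>\<^sub>F r in at_left q. f (time_scale_floor S a r) = f a"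
    unfolding eventually_at_left_field using True
    by (intro exI[of _ "q - 1"]) (auto simp: time_scale_floor_below)
  then show ?thesis using tendsto_eventually by metis
next
  case False
  show ?thesis
  proof (cases "\<exists>d<q. \<forall>r\<in>S. d < r \<longrightarrow> q \<le> r")
    case True
    then obtain d where d: "d < q" "\<forall>r\<in>S. d < r \<longrightarrow> q \<le> r" by metis
    have "time_scale_floor S a r = time_scale_floor S a d" if "max a d < r" "r < q" for r
    proof (rule time_scale_floor_eqI)
      have "a \<le> d" using d False S(2) by force
      then show "time_scale_floor S a d \<le> r" using time_scale_floor_le[of d] that by simp
      fix p assume p: "p \<in> S" "p \<le> r"
      then have "p \<le> d" using d(2) that by force
      then show "p \<le> time_scale_floor S a d" using p time_scale_floor_ge by simp
    qed (rule time_scale_floor_mem)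
    then have "\<forall>\<^sub>F r in at_left q. f (time_scale_floor S a r) = f (time_scale_floor S a d)"
      unfolding eventually_at_left_field using False d(1) by (intro exI[of _ "max a d"]) auto
    then show ?thesis using tendsto_eventually by metis
  next
    case dense: False
    have "q islimpt S"
      unfolding islimpt_approachable
    proof (intro allI impI)
      fix e :: real assume "e > 0"
      then obtain r where "r \<in> S" "q - e < r" "r < q" using dense by (metis diff_gt_0_iff_gt diff_less_eq less_add_same_cancel1 not_le)
      then show "\<exists>r\<in>S. r \<noteq> q \<and> dist r q < e" by (intro bexI[of _ r]) (auto simp: dist_real_def)
    qed
    then have "q \<in> S" using S(1) by (simp add: closed_limpt)
    then obtain L where L: "\<And>e. e > 0 \<Longrightarrow> \<exists>d>0. \<forall>r\<in>S. q - d < r \<longrightarrow> r < q \<longrightarrow> \<bar>f r - L\<bar> < e"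
      using rd_continuous_left[OF f] by metis
    have "((\<lambda>r. f (time_scale_floor S a r)) \<longlongrightarrow> L) (at_left q)"
    proof (rule tendstoI)
      fix e :: real assume "e > 0"
      then obtain d where d: "d > 0" "\<forall>r\<in>S. q - d < r \<longrightarrow> r < q \<longrightarrow> \<bar>f r - L\<bar> < e" using L by metis
      obtain r0 where r0: "r0 \<in> S" "q - d < r0" "r0 < q"
        using dense d(1) by (metis diff_gt_0_iff_gt diff_less_eq less_add_same_cancel1 not_le)
      have "dist (f (time_scale_floor S a r)) L < e" if "r0 < r" "r < q" for r
      proof -
        have "a \<le> r0" using r0 S(3) by auto
        then have "r0 \<le> time_scale_floor S a r" "time_scale_floor S a r \<le> r" "time_scale_floor S a r \<in> S"
          using that r0 by (auto intro: time_scale_floor_mem time_scale_floor_le time_scale_floor_ge)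
        then show ?thesis using d(2) r0 that by (simp add: dist_real_def)
      qed
      then show "\<forall>\<^sub>F r in at_left q. dist (f (time_scale_floor S a r)) L < e"
        unfolding eventually_at_left_field using r0 by metis
    qed
    then show ?thesis ..
  qed
qed

text \<open>Between t and \<sigma>(t) the integrand is the constant \<open>f t\<close>, which is the
  jump identity. At a right-dense t the floors of nearby points are near t, so the integrand is
  uniformly close to \<open>f t\<close>.\<close>

lemma delta_antiderivative_exists:
  assumes unbdd: "\<not> bdd_above S" and f: "rd_continuous S f"
  shows "\<exists>F. \<forall>t\<in>S. has_delta_derivative S F (f t) t"
proof -
  define h where "h r = f (time_scale_floor S a r)" for r
  define F where "F t = integral {a..t} h" for t
  have int: "h integrable_on {p..q}" for p q
    by (rule regulated_integrable_on)
      (use rd_continuous_floor_right[OF f] rd_continuous_floor_left[OF f] in \<open>unfold h_def, metis+\<close>)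
  have F_diff: "F r - F t = integral {t..r} h" if "a \<le> t" "t \<le> r" for t r
    using Henstock_Kurzweil_Integration.integral_combine[OF that int] by (simp add: F_def)
  have h_eq: "h r = f t" if "t \<in> S" "t \<le> r" "r < fwd_jump S t" for r t
  proof -
    have "time_scale_floor S a r = t"
      by (rule time_scale_floor_eqI) (use that fwd_jump_le[of _ S t] in force)+
    then show ?thesis by (simp add: h_def)
  qed
  have cont: "continuous (at t within S) F" if t: "t \<in> S" for t
  proof -
    have "continuous_on {a..t + 1} F"
      unfolding F_def by (rule indefinite_integral_continuous_1[OF int])
    then have "continuous (at t within {a..t + 1}) F"
      using t S(3) by (auto simp: continuous_on_eq_continuous_within)
    moreover have "at t within {a..t + 1} = at t within {a..}"
      by (rule at_within_nhd[of t "{..<t + 1}"]) auto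
    ultimately have "continuous (at t within {a..}) F" by simp
    then show ?thesis using S(3) by (rule continuous_within_subset)
  qed
  have jump: "F (fwd_jump S t) = F t + graininess S t * f t" if t: "t \<in> S" for t
  proof -
    have const: "((\<lambda>_. f t) has_integral (fwd_jump S t - t) * f t) {t..fwd_jump S t}"
      using has_integral_const_real[of "f t" t "fwd_jump S t"] fwd_jump_ge[of t S] by simp
    have "(h has_integral (fwd_jump S t - t) * f t) {t..fwd_jump S t}"
      by (rule has_integral_spike_finite[where S = "{fwd_jump S t}", OF _ _ const]) (auto intro: h_eq[OF t])
    then have "integral {t..fwd_jump S t} h = (fwd_jump S t - t) * f t" by (rule integral_unique)
    then show ?thesis using F_diff[of t "fwd_jump S t"] t S(3) fwd_jump_ge[of t S]
      by (auto simp: graininess_def)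
  qed
  have deriv: "(F has_real_derivative f t) (at t within S)" if t: "t \<in> S" and st: "fwd_jump S t = t" for t
    unfolding has_field_derivative_def has_derivative_within_alt
  proof (intro conjI allI impI bounded_linear_mult_right)
    fix e :: real assume e: "e > 0"
    \<comment> \<open>A maximum of \<open>S\<close> also satisfies \<open>fwd_jump S t = t\<close>,
      yet it is not right-dense and \<open>f\<close> could jump there; unboundedness rules it
      out.\<close>
    have "S \<inter> {t<..} \<noteq> {}" using unbdd by (force simp: bdd_above_def not_le)
    then have "continuous (at t within S) f"
      using f t st by (auto simp: rd_continuous_def right_dense_iff)
    then obtain d where d: "d > 0" "\<And>r. r \<in> S \<Longrightarrow> dist r t < d \<Longrightarrow> dist (f r) (f t) < e"
      using e unfolding continuous_within_eps_delta by metis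
    \<comment> \<open>Stated for two points p \<le> q of \<open>S\<close>, so that t can serve as
      either end. The floor of a point between them stays between them.\<close>
    have bound: "\<bar>F q - F p - f t * (q - p)\<bar> \<le> e * (q - p)"
      if pq: "p \<in> S" "q \<in> S" "p \<le> q" "t - d < p" "q < t + d" for p q
    proof -
      have "a \<le> p" using pq S(3) by auto
      have "\<bar>h r - f t\<bar> \<le> e" if r: "r \<in> {p..q}" for r
      proof -
        have "p \<le> time_scale_floor S a r" "time_scale_floor S a r \<le> r"
          using pq r \<open>a \<le> p\<close> by (auto intro: time_scale_floor_le time_scale_floor_ge)
        then have "dist (f (time_scale_floor S a r)) (f t) < e"
          using pq r by (intro d(2) time_scale_floor_mem) (auto simp: dist_real_def)
        then show ?thesis by (simp add: h_def dist_real_def)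
      qed
      moreover have "((\<lambda>r. h r - f t) has_integral integral {p..q} h - (q - p) * f t) {p..q}"
        using has_integral_diff[OF integrable_integral[OF int] has_integral_const_real[of "f t" p q]] pq
        by simp
      ultimately have "norm (integral {p..q} h - (q - p) * f t) \<le> e * measure lborel {p..q}"
        using e by (intro has_integral_bound_real[where S = "{}"]) auto
      then show ?thesis using pq F_diff[OF \<open>a \<le> p\<close> pq(3)] by (simp add: mult.commute)
    qed
    have "norm (F r - F t - f t * (r - t)) \<le> e * norm (r - t)" if "r \<in> S" "norm (r - t) < d" for r
    proof (cases "t \<le> r")
      case True
      then show ?thesis using bound[of t r] that t d(1) by auto
    next
      case False
      have "\<bar>F r - F t - f t * (r - t)\<bar> = \<bar>F t - F r - f t * (t - r)\<bar>"
        by (subst abs_minus_cancel[symmetric]) (simp add: algebra_simps)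
      then show ?thesis using bound[of r t] that t d(1) False by auto
    qed
    then show "\<exists>d>0. \<forall>r\<in>S. norm (r - t) < d \<longrightarrow> norm (F r - F t - f t * (r - t)) \<le> e * norm (r - t)"
      using d(1) by metis
  qed
  show ?thesis using cont jump deriv by (auto simp: has_delta_derivative_iff)
qed

end

section \<open>Time scale exponentials as exponentials of antiderivatives\<close>

lemma has_delta_derivative_exp:
  assumes I: "has_delta_derivative S I (cylinder (graininess S t) z) t"
    and t: "t \<in> S" and reg: "0 < 1 + graininess S t * z"
  shows "has_delta_derivative S (\<lambda>t. exp (I t)) (z * exp (I t)) t"
proof -
  let ?\<mu> = "graininess S t"
  have I': "continuous (at t within S) I" "I (fwd_jump S t) = I t + ?\<mu> * cylinder ?\<mu> z"
    "fwd_jump S t = t \<Longrightarrow> (I has_real_derivative cylinder ?\<mu> z) (at t within S)"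
    using I t by (auto simp: has_delta_derivative_iff)
  \<comment> \<open>The cylinder transformation is made for this: it turns the additive jump of
    \<open>I\<close> into multiplication by 1 + \<mu> z.\<close>
  have "exp (?\<mu> * cylinder ?\<mu> z) = 1 + ?\<mu> * z"
    using reg by (simp add: cylinder_def)
  then have "exp (I (fwd_jump S t)) = exp (I t) + ?\<mu> * (z * exp (I t))"
    unfolding I'(2) exp_add by (simp add: algebra_simps)
  moreover have "((\<lambda>t. exp (I t)) has_real_derivative z * exp (I t)) (at t within S)" if "fwd_jump S t = t"
    using that by (auto intro!: derivative_eq_intros I'(3) simp: graininess_def cylinder_def)
  ultimately show ?thesis
    using t I'(1) by (auto simp: has_delta_derivative_iff intro: continuous_intros)
qed

lemma ts_exp_eq:
  assumes "closed S" "s \<in> S" "t \<in> S"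
    and "\<And>u. u \<in> S \<Longrightarrow> has_delta_derivative S I (cylinder (graininess S u) (f u)) u"
  shows "ts_exp S f t s = exp (I t - I s)"
  unfolding ts_exp_def using delta_integral_eq[OF assms] by simp

subsection \<open>The delay equation\<close>

lemma has_delta_derivative_cmult:
  assumes "has_delta_derivative S f D t" "t \<in> S"
  shows "has_delta_derivative S (\<lambda>t. c * f t) (c * D) t"
  using assms
  by (auto simp: has_delta_derivative_iff algebra_simps intro!: continuous_intros derivative_eq_intros)

lemma delta_derivative_nonneg_mono:
  assumes "closed S" "a \<in> S" "b \<in> S" "a \<le> b"
    and "\<And>t. t \<in> S \<Longrightarrow> has_delta_derivative S F (f t) t" "\<And>t. t \<in> S \<Longrightarrow> 0 \<le> f t"
  shows "F a \<le> F b"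
proof -
  have "has_delta_derivative S (\<lambda>_. 0) 0 t" if "t \<in> S" for t
    using that by (auto simp: has_delta_derivative_iff)
  from delta_derivative_mono[OF assms(1-4), of "\<lambda>_. 0" "\<lambda>_. 0" F f] this assms(5,6)
  show ?thesis by auto
qed

section \<open>Pointwise estimates for the cylinder transformation\<close>

lemma cylinder_le: "0 \<le> h \<Longrightarrow> 0 \<le> z \<Longrightarrow> cylinder h z \<le> z"
  using ln_add_one_self_le_self[of "h * z"] by (auto simp: cylinder_def divide_simps mult.commute)

lemma cylinder_neg_nonpos: "0 \<le> h \<Longrightarrow> 0 \<le> z \<Longrightarrow> h * z < 1 \<Longrightarrow> cylinder h (- z) \<le> 0"
  by (auto simp: cylinder_def divide_simps)

text \<open>With y = c h z, which is at most c, one has -ln(1 - y) \<le> y/(1 - y) \<le> y/(1 - c).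
  This limits how fast w can decay on the initial stretch.\<close>

lemma cylinder_neg_ge:
  assumes "0 \<le> h" "0 \<le> z" "h * z < 1" "0 < c" "c < 1"
  shows "- (c / (1 - c)) * z \<le> cylinder h (- c * z)"
proof (cases "h = 0")
  case True
  have "c * (1 - c) * z \<le> c * z" using assms by (simp add: mult_left_le mult_right_mono)
  then show ?thesis using True assms by (simp add: cylinder_def field_simps)
next
  case False
  then have h: "0 < h" using assms by simp
  define y where "y = c * (h * z)"
  have y: "0 \<le> y" "y \<le> c" using assms by (auto simp: y_def mult_left_le)
  have "ln (1 + y / (1 - y)) \<le> y / (1 - y)"
    using y assms by (intro ln_add_one_self_le_self) auto
  moreover have "1 + y / (1 - y) = inverse (1 - y)" using y assms by (simp add: field_simps)
  then have "ln (1 + y / (1 - y)) = - ln (1 - y)" using y assms by (simp add: ln_inverse)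
  moreover have "y / (1 - y) \<le> y / (1 - c)" using y assms by (intro divide_left_mono) auto
  ultimately have "- (y / (1 - c)) / h \<le> ln (1 - y) / h" using h by (intro divide_right_mono) auto
  moreover have "- (y / (1 - c)) / h = - (c / (1 - c)) * z" using h by (simp add: y_def)
  ultimately show ?thesis using h by (simp add: cylinder_def y_def mult_ac)
qed

text \<open>Pointwise form of 1/e_{-cA} \<le> e_{c(\<ominus>(-A))}. With y = h z it comes down to (1
  - y + c y)(1 - c y) - (1 - y) = c (1 - c) y^2 \<ge> 0.\<close>

lemma cylinder_neg_le:
  assumes "0 \<le> h" "0 \<le> z" "h * z < 1" "0 < c" "c < 1"
  shows "- cylinder h (- c * z) \<le> cylinder h (c * (z / (1 - h * z)))"
proof (cases "h = 0")
  case False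
  then have h: "0 < h" using assms by simp
  define y where "y = h * z"
  have y: "0 \<le> y" "y < 1" using assms by (auto simp: y_def)
  have "c * y \<le> 1 * y" using y assms by (intro mult_right_mono) auto
  then have cy: "c * y < 1" using y by simp
  have "1 - y \<le> (1 - y + c * y) * (1 - c * y)"
  proof -
    have "(1 - y + c * y) * (1 - c * y) - (1 - y) = c * (1 - c) * y\<^sup>2"
      by (simp add: power2_eq_square algebra_simps)
    also have "\<dots> \<ge> 0" using assms by simp
    finally show ?thesis by simp
  qed
  then have "1 / (1 - c * y) \<le> (1 - y + c * y) / (1 - y)" using y cy by (simp add: field_simps)
  also have "\<dots> = 1 + c * y / (1 - y)" using y by (simp add: field_simps)
  finally have "ln (1 / (1 - c * y)) \<le> ln (1 + c * y / (1 - y))" using y cy by (intro ln_mono) auto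
  then have "- ln (1 - c * y) \<le> ln (1 + c * y / (1 - y))" using cy by (simp add: ln_div)
  then have "- ln (1 - c * y) / h \<le> ln (1 + c * y / (1 - y)) / h" using h by (intro divide_right_mono) auto
  then show ?thesis using h by (simp add: cylinder_def y_def mult_ac)
qed (use assms in \<open>simp add: cylinder_def\<close>)

text \<open>Closedness of \<open>U\<close> keeps the left limits of \<open>g\<close> inside
  \<open>U\<close>, where \<psi> is continuous. Needed for an antiderivative composed with the
  delay, which is continuous only on the time scale.\<close>

lemma rd_continuous_compose:
  assumes g: "rd_continuous S g" and U: "closed U" "\<And>t. t \<in> S \<Longrightarrow> g t \<in> U"
    and \<psi>: "continuous_on U \<psi>"
  shows "rd_continuous S (\<lambda>t. \<psi> (g t))"
proof -
  have ev: "\<forall>\<^sub>F r in at t within R. g r \<in> U" if "R \<subseteq> S" for t R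
    using U(2) that by (auto simp: eventually_at_filter intro!: always_eventually)
  show ?thesis
    unfolding rd_continuous_def
  proof (intro conjI ballI impI)
    fix t assume t: "t \<in> S" "right_dense S t"
    then have "(g \<longlongrightarrow> g t) (at t within S)" using g by (auto simp: rd_continuous_def continuous_within)
    from continuous_on_tendsto_compose[OF \<psi> this U(2)[OF t(1)] ev]
    show "continuous (at t within S) (\<lambda>t. \<psi> (g t))" by (simp add: continuous_within)
  next
    fix t assume t: "t \<in> S" "left_dense S t"
    then obtain L where L: "(g \<longlongrightarrow> L) (at t within (S \<inter> {..<t}))" using g by (auto simp: rd_continuous_def)
    have "t islimpt (S \<inter> {..<t})"
      unfolding islimpt_approachable
    proof (intro allI impI)
      fix e :: real assume "e > 0"
      then obtain r where "r \<in> S" "t - e < r" "r < t"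
        using t(2) by (auto simp: left_dense_iff dest: spec[of _ "t - e"])
      then show "\<exists>r\<in>S \<inter> {..<t}. r \<noteq> t \<and> dist r t < e" by (intro bexI[of _ r]) (auto simp: dist_real_def)
    qed
    then have "at t within (S \<inter> {..<t}) \<noteq> bot" by (simp add: trivial_limit_within)
    then have "L \<in> U" by (rule Lim_in_closed_set[OF U(1) ev _ L, rotated]) auto
    from continuous_on_tendsto_compose[OF \<psi> L this ev]
    show "\<exists>L. ((\<lambda>t. \<psi> (g t)) \<longlongrightarrow> L) (at t within (S \<inter> {..<t}))" by auto
  qed
qed

section \<open>The running infimum of the delay\<close>

lemma delay_star_Int_atLeast: "a \<le> t \<Longrightarrow> delay_star (T \<inter> {a..}) \<alpha> t = delay_star T \<alpha> t"
proof -
  assume "a \<le> t"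
  then have "T \<inter> {a..} \<inter> {t..} = T \<inter> {t..}" by auto
  then show ?thesis by (simp add: delay_star_def)
qed

text \<open>The limit at infinity bounds the tail and rd-continuity bounds the initial part. This
  gives meaning to the infimum in \<open>delay_star\<close>.\<close>

lemma delay_bdd_below:
  assumes "closed S" "S \<subseteq> {a..}" "rd_continuous S \<alpha>"
    and lim: "filterlim \<alpha> at_top (inf at_top (principal S))"
  shows "bdd_below (\<alpha> ` S)"
proof -
  obtain K where K: "\<And>r. K \<le> r \<Longrightarrow> r \<in> S \<Longrightarrow> 0 \<le> \<alpha> r"
    using lim unfolding filterlim_at_top eventually_inf_principal eventually_at_top_linorder by metis
  obtain B where B: "\<forall>r\<in>S. a \<le> r \<longrightarrow> r \<le> K \<longrightarrow> \<bar>\<alpha> r\<bar> \<le> B"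
    using rd_continuous_bounded[OF assms(1,3)] by metis
  have "- \<bar>B\<bar> \<le> \<alpha> r" if "r \<in> S" for r
  proof (cases "K \<le> r")
    case True
    then show ?thesis using K[OF True that] by linarith
  next
    case False
    then have "\<bar>\<alpha> r\<bar> \<le> B" using B that assms(2) by auto
    then show ?thesis by linarith
  qed
  then show ?thesis by (auto intro!: bdd_belowI)
qed

context
  fixes S :: "real set" and \<alpha> :: "real \<Rightarrow> real"
  assumes \<alpha>_bdd: "bdd_below (\<alpha> ` S)"
begin

lemma delay_star_le: "r \<in> S \<Longrightarrow> t \<le> r \<Longrightarrow> delay_star S \<alpha> t \<le> \<alpha> r"
  unfolding delay_star_def by (rule cInf_lower) (auto intro: bdd_below_mono[OF \<alpha>_bdd])

lemma delay_star_greatest: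
  "t \<in> S \<Longrightarrow> (\<And>r. r \<in> S \<Longrightarrow> t \<le> r \<Longrightarrow> c \<le> \<alpha> r) \<Longrightarrow> c \<le> delay_star S \<alpha> t"
  unfolding delay_star_def by (rule cInf_greatest) auto

lemma delay_star_mono: "q \<in> S \<Longrightarrow> r \<le> q \<Longrightarrow> delay_star S \<alpha> r \<le> delay_star S \<alpha> q"
  by (rule delay_star_greatest) (auto intro: delay_star_le)

lemma delay_star_mem:
  assumes "closed T" "t \<in> S" "\<And>r. r \<in> S \<Longrightarrow> \<alpha> r \<in> T"
  shows "delay_star S \<alpha> t \<in> T"
  unfolding delay_star_def
  by (rule closed_subset_contains_Inf[OF assms(1)]) (use assms in \<open>auto intro: bdd_below_mono[OF \<alpha>_bdd]\<close>)

text \<open>Near a right-dense point, infima over two tails differ only through values of \<alpha>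
  close to each other; at a left-dense point, monotonicity provides the limit. It is needed so that
  the integrand in the hypothesis on \<open>lam\<^sub>0\<close> has an antiderivative.\<close>

lemma rd_continuous_delay_star:
  assumes \<alpha>: "rd_continuous S \<alpha>"
  shows "rd_continuous S (delay_star S \<alpha>)"
  unfolding rd_continuous_def
proof (intro conjI ballI impI)
  fix t assume t: "t \<in> S" "right_dense S t"
  then have c: "continuous (at t within S) \<alpha>" using \<alpha> by (simp add: rd_continuous_def)
  show "continuous (at t within S) (delay_star S \<alpha>)"
    unfolding continuous_within_eps_delta
  proof (intro allI impI)
    fix e :: real assume "e > 0"
    then have "e / 3 > 0" by simp
    then obtain d where d: "d > 0" "\<And>r. r \<in> S \<Longrightarrow> dist r t < d \<Longrightarrow> dist (\<alpha> r) (\<alpha> t) < e / 3"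
      using c unfolding continuous_within_eps_delta by metis
    have close: "delay_star S \<alpha> q - 2 * (e / 3) \<le> delay_star S \<alpha> r"
      if "r \<in> S" "q \<in> S" "r \<le> q" "dist r t < d" "dist q t < d" for r q
    proof (rule delay_star_greatest[OF that(1)])
      fix p assume p: "p \<in> S" "r \<le> p"
      show "delay_star S \<alpha> q - 2 * (e / 3) \<le> \<alpha> p"
      proof (cases "q \<le> p")
        case True
        then show ?thesis using delay_star_le[OF p(1) True] \<open>e > 0\<close> by simp
      next
        case False
        have "dist p t < d" using False p that by (auto simp: dist_real_def)
        then have "\<bar>\<alpha> p - \<alpha> t\<bar> < e / 3" "\<bar>\<alpha> q - \<alpha> t\<bar> < e / 3"
          using d(2)[of p] d(2)[of q] p that by (auto simp: dist_real_def)
        moreover have "delay_star S \<alpha> q \<le> \<alpha> q" using that by (intro delay_star_le) auto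
        ultimately show ?thesis by linarith
      qed
    qed
    have "dist (delay_star S \<alpha> r) (delay_star S \<alpha> t) < e" if "r \<in> S" "dist r t < d" for r
      using close[of r t] close[of t r] delay_star_mono[of r t] delay_star_mono[of t r] that t(1) d(1) \<open>e > 0\<close>
      by (cases "r \<le> t") (auto simp: dist_real_def)
    then show "\<exists>d>0. \<forall>r\<in>S. dist r t < d \<longrightarrow> dist (delay_star S \<alpha> r) (delay_star S \<alpha> t) < e"
      using d(1) by metis
  qed
next
  fix t assume t: "t \<in> S" "left_dense S t"
  let ?L = "Sup (delay_star S \<alpha> ` (S \<inter> {..<t}))"
  have ne: "S \<inter> {..<t} \<noteq> {}" using t(2) by (auto simp: left_dense_def)
  have bdd: "bdd_above (delay_star S \<alpha> ` (S \<inter> {..<t}))"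
    using t(1) by (intro bdd_aboveI[of _ "delay_star S \<alpha> t"]) (auto intro: delay_star_mono)
  have "(delay_star S \<alpha> \<longlongrightarrow> ?L) (at t within (S \<inter> {..<t}))"
  proof (rule increasing_tendsto)
    show "\<forall>\<^sub>F r in at t within (S \<inter> {..<t}). delay_star S \<alpha> r \<le> ?L"
      using bdd by (auto simp: eventually_at_filter intro!: eventuallyI cSup_upper)
  next
    fix y assume "y < ?L"
    then obtain r0 where r0: "r0 \<in> S" "r0 < t" "y < delay_star S \<alpha> r0"
      using less_cSupD[of "delay_star S \<alpha> ` (S \<inter> {..<t})" y] ne by auto
    have "y < delay_star S \<alpha> r" if "r \<in> S" "r0 \<le> r" for r
      using r0(3) delay_star_mono[OF that] by simp
    then show "\<forall>\<^sub>F r in at t within (S \<inter> {..<t}). y < delay_star S \<alpha> r"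
      unfolding eventually_at using r0(2)
      by (intro exI[of _ "t - r0"]) (auto simp: dist_real_def)
  qed
  then show "\<exists>L. (delay_star S \<alpha> \<longlongrightarrow> L) (at t within (S \<inter> {..<t}))" ..
qed

end

lemma sup_abs_upper:
  assumes "q \<in> I" "\<And>q. q \<in> I \<Longrightarrow> \<bar>\<phi> q\<bar> \<le> B"
  shows "\<bar>\<phi> q\<bar> \<le> sup_abs I \<phi>"
  unfolding sup_abs_def
  by (rule cSup_upper) (use assms in \<open>auto intro!: bdd_aboveI[of _ "max 0 B"] simp: le_max_iff_disj\<close>)

theorem theorem4p6:
  fixes T S :: "real set" and t\<^sub>0 lam\<^sub>0 M\<^sub>1 lam\<^sub>1 :: real and A \<alpha> :: "real \<Rightarrow> real"
  assumes "S = T \<inter> {t\<^sub>0..}"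
    and "time_scale T" and "\<not> bdd_above T" and "t\<^sub>0 \<in> T"
    and "rd_continuous S A" and "\<And>t. t \<in> S \<Longrightarrow> 0 \<le> A t"
    and "rd_continuous S \<alpha>" and "\<And>t. t \<in> S \<Longrightarrow> \<alpha> t \<in> T"
    and "\<And>t. t \<in> S \<Longrightarrow> \<alpha> t \<le> t"
    and "filterlim \<alpha> at_top (inf at_top (principal S))"
    and "\<And>t. t \<in> S \<Longrightarrow> \<alpha> (fwd_jump T t) \<le> t"
    and "(SUP s\<in>S. ereal (delta_integral S A s (delay_inv T t\<^sub>0 \<alpha> s))) < \<infinity>"
    and "(SUP s\<in>S. ereal (delay_inv T t\<^sub>0 \<alpha> s - s)) < \<infinity>"
    and "(SUP t\<in>S. ereal (delta_integral S A (max t\<^sub>0 (delay_star T \<alpha> t)) t)) < 1"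
    and "0 < lam\<^sub>0" and "lam\<^sub>0 < 1"
    and "\<And>t. t \<in> S \<Longrightarrow>
      delta_integral S
        (\<lambda>\<eta>. ts_exp S (\<lambda>u. lam\<^sub>0 * circle_minus S (\<lambda>v. - A v) u)
                (fwd_jump T t) (max t\<^sub>0 (delay_star T \<alpha> \<eta>)) * A \<eta>)
        (max t\<^sub>0 (delay_star T \<alpha> t)) t < 1 - lam\<^sub>0"
    and "0 < M\<^sub>1" and "0 < lam\<^sub>1"
    and "\<And>t s. \<lbrakk>t \<in> T; s \<in> T; t \<ge> s; s \<ge> t\<^sub>0\<rbrakk> \<Longrightarrow>
      ts_exp S (\<lambda>u. - lam\<^sub>0 * A u) t s \<le> M\<^sub>1 * ts_exp S (circle_minus S (\<lambda>_. lam\<^sub>1)) t s"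
  shows "uniformly_exponentially_stable T t\<^sub>0 A \<alpha>"
proof -
  have closed_T: "closed T" using assms(2) by (simp add: time_scale_def)
  then have closed_S: "closed S" using assms(1) by (auto intro: closed_Int)
  have S: "t\<^sub>0 \<in> S" "S \<subseteq> {t\<^sub>0..}" using assms(1,4) by auto
  have unbdd: "\<not> bdd_above S"
  proof
    assume "bdd_above S"
    then obtain B where B: "\<And>r. r \<in> S \<Longrightarrow> r \<le> B" by (auto simp: bdd_above_def)
    have "bdd_above T" using B assms(1) by (intro bdd_aboveI[of _ "max B t\<^sub>0"]) force
    then show False using assms(3) by simp
  qed
  note S_facts = closed_S S
  have jump_T: "fwd_jump T t = fwd_jump S t" if "t \<in> S" for t
    using that assms(1) fwd_jump_Int_atLeast[of t\<^sub>0 t T] by simp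
  have jump_S: "fwd_jump S t \<in> S" if "t \<in> S" for t
    using fwd_jump_mem[OF closed_S that] .
  note A_nonneg = assms(6)
  note \<mu>_nonneg = graininess_nonneg[of S]

  define D where "D = delay_star S \<alpha>"
  have D_T: "delay_star T \<alpha> t = D t" if "t \<in> S" for t
    using that assms(1) delay_star_Int_atLeast[of t\<^sub>0 t T \<alpha>] by (simp add: D_def)
  have \<alpha>_bdd: "bdd_below (\<alpha> ` S)"
    by (rule delay_bdd_below[OF closed_S S(2) assms(7,10)])
  have D_le: "D t \<le> \<alpha> r" if "r \<in> S" "t \<le> r" for t r
    unfolding D_def by (rule delay_star_le[OF \<alpha>_bdd that])
  have D_mono: "D r \<le> D t" if "t \<in> S" "r \<le> t" for r t
    unfolding D_def by (rule delay_star_mono[OF \<alpha>_bdd that])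
  have D_self: "D t \<le> t" if "t \<in> S" for t
    using D_le[OF that] assms(9)[OF that] by fastforce
  have D_mem: "max t\<^sub>0 (D t) \<in> S" if "t \<in> S" for t
  proof -
    have "D t \<in> T" unfolding D_def by (rule delay_star_mem[OF \<alpha>_bdd closed_T that assms(8)])
    then show ?thesis using assms(1,4) by (auto simp: max_def)
  qed
  have D_rd: "rd_continuous S D" unfolding D_def by (rule rd_continuous_delay_star[OF \<alpha>_bdd assms(7)])

  note ex = delta_antiderivative_exists[OF S_facts unbdd]
  have rd_neg: "rd_continuous S (\<lambda>u. - A u)"
    using rd_continuous_cmult[OF assms(5), of "- 1"] by simp
  \<comment> \<open>Up to constant factors, exp I is w, exp E is e_{-A}, exp G is e_A, and exp J is
    the exponential in the hypothesis on \<open>lam\<^sub>0\<close>. All live on the whole of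
    \<open>S\<close>, independently of the initial time.\<close>
  obtain H where H: "\<And>t. t \<in> S \<Longrightarrow> has_delta_derivative S H (A t) t"
    using ex[OF assms(5)] by metis
  obtain I where I: "\<And>t. t \<in> S \<Longrightarrow> has_delta_derivative S I (cylinder (graininess S t) (- lam\<^sub>0 * A t)) t"
    using ex[OF rd_continuous_cylinder[OF rd_continuous_cmult[OF assms(5)]]] by metis
  obtain E where E: "\<And>t. t \<in> S \<Longrightarrow> has_delta_derivative S E (cylinder (graininess S t) (- A t)) t"
    using ex[OF rd_continuous_cylinder[OF rd_neg]] by metis
  obtain G where G: "\<And>t. t \<in> S \<Longrightarrow> has_delta_derivative S G (cylinder (graininess S t) (A t)) t"
    using ex[OF rd_continuous_cylinder[OF assms(5)]] by metis
  obtain J where J: "\<And>t. t \<in> S \<Longrightarrow> has_delta_derivative S J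
      (cylinder (graininess S t) (lam\<^sub>0 * circle_minus S (\<lambda>v. - A v) t)) t"
    using ex[OF rd_continuous_cylinder[OF rd_continuous_cmult[OF rd_continuous_circle_minus[OF rd_neg]]]] by metis

  have H_mono: "H p \<le> H q" if "p \<in> S" "q \<in> S" "p \<le> q" for p q
    by (rule delta_derivative_nonneg_mono[OF closed_S that H A_nonneg])
  \<comment> \<open>The integral bound at \<sigma>(t) runs over an interval containing
    [t, \<sigma>(t)], because \<alpha>(\<sigma>(t)) \<le> t; on that piece the integral is \<mu>(t)
    A(t).\<close>
  have reg: "graininess S t * A t < 1" if t: "t \<in> S" for t
  proof -
    let ?\<sigma> = "fwd_jump S t"
    have \<sigma>: "?\<sigma> \<in> S" by (rule jump_S[OF t])
    have "delta_integral S A (max t\<^sub>0 (delay_star T \<alpha> ?\<sigma>)) ?\<sigma> < 1"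
    proof -
      have "ereal (delta_integral S A (max t\<^sub>0 (delay_star T \<alpha> ?\<sigma>)) ?\<sigma>) < 1"
        by (rule le_less_trans[OF SUP_upper[OF \<sigma>] assms(14)])
      then show ?thesis by simp
    qed
    then have "H ?\<sigma> - H (max t\<^sub>0 (D ?\<sigma>)) < 1"
      using delta_integral_eq[OF closed_S D_mem[OF \<sigma>] \<sigma> H] D_T[OF \<sigma>] by simp
    moreover have "H (max t\<^sub>0 (D ?\<sigma>)) \<le> H t"
    proof (rule H_mono[OF D_mem[OF \<sigma>] t])
      have "D ?\<sigma> \<le> t" using D_le[OF \<sigma> order_refl] assms(11)[OF t] jump_T[OF t] by simp
      then show "max t\<^sub>0 (D ?\<sigma>) \<le> t" using t S(2) by auto
    qed
    moreover have "H ?\<sigma> = H t + graininess S t * A t"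
      using H[OF t] t by (simp add: has_delta_derivative_iff)
    ultimately show ?thesis by simp
  qed
  have reg_lam: "graininess S t * (lam\<^sub>0 * A t) < 1" if t: "t \<in> S" for t
  proof -
    have "lam\<^sub>0 * (graininess S t * A t) \<le> 1 * (graininess S t * A t)"
      using assms(16) \<mu>_nonneg A_nonneg[OF t] by (intro mult_right_mono) auto
    then show ?thesis using reg[OF t] by (simp add: mult_ac)
  qed

  have exp_I: "has_delta_derivative S (\<lambda>t. exp (I t)) (- lam\<^sub>0 * A t * exp (I t)) t" if t: "t \<in> S" for t
    using has_delta_derivative_exp[OF I[OF t] t] reg_lam[OF t] by simp
  have exp_E: "has_delta_derivative S (\<lambda>t. exp (E t)) (- A t * exp (E t)) t" if t: "t \<in> S" for t
    using has_delta_derivative_exp[OF E[OF t] t] reg[OF t] by simp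
  have exp_G: "has_delta_derivative S (\<lambda>t. exp (G t)) (A t * exp (G t)) t" if t: "t \<in> S" for t
    using has_delta_derivative_exp[OF G[OF t] t] \<mu>_nonneg[of t] A_nonneg[OF t]
    by (simp add: add_pos_nonneg)
  have G_mono: "exp (G p) \<le> exp (G q)" if "p \<in> S" "q \<in> S" "p \<le> q" for p q
    by (rule delta_derivative_nonneg_mono[OF closed_S that exp_G]) (auto intro!: mult_nonneg_nonneg A_nonneg)
  have I_anti: "I q \<le> I p" if "p \<in> S" "q \<in> S" "p \<le> q" for p q
  proof -
    have "- 1 * I p \<le> - 1 * I q"
    proof (rule delta_derivative_nonneg_mono[OF closed_S that])
      fix t assume t: "t \<in> S"
      show "has_delta_derivative S (\<lambda>t. - 1 * I t) (- 1 * cylinder (graininess S t) (- lam\<^sub>0 * A t)) t"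
        by (rule has_delta_derivative_cmult[OF I[OF t] t])
      show "0 \<le> - 1 * cylinder (graininess S t) (- lam\<^sub>0 * A t)"
        using cylinder_neg_nonpos[OF \<mu>_nonneg _ reg_lam[OF t]] assms(15) A_nonneg[OF t] by simp
    qed
    then show ?thesis by simp
  qed
  have G_le_H: "G q - G p \<le> H q - H p" if "p \<in> S" "q \<in> S" "p \<le> q" for p q
    by (rule delta_derivative_mono[OF closed_S that G H]) (auto intro: cylinder_le \<mu>_nonneg A_nonneg)
  have I_ge_H: "- (lam\<^sub>0 / (1 - lam\<^sub>0)) * H q - - (lam\<^sub>0 / (1 - lam\<^sub>0)) * H p \<le> I q - I p"
    if "p \<in> S" "q \<in> S" "p \<le> q" for p q
  proof (rule delta_derivative_mono[OF closed_S that has_delta_derivative_cmult[OF H] I])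
    fix t assume t: "t \<in> S"
    show "- (lam\<^sub>0 / (1 - lam\<^sub>0)) * A t \<le> cylinder (graininess S t) (- lam\<^sub>0 * A t)"
      by (rule cylinder_neg_ge[OF \<mu>_nonneg A_nonneg[OF t] reg[OF t] assms(15,16)])
  qed auto
  have I_le_J: "- 1 * I q - - 1 * I p \<le> J q - J p" if "p \<in> S" "q \<in> S" "p \<le> q" for p q
  proof (rule delta_derivative_mono[OF closed_S that has_delta_derivative_cmult[OF I] J])
    fix t assume t: "t \<in> S"
    show "- 1 * cylinder (graininess S t) (- lam\<^sub>0 * A t)
        \<le> cylinder (graininess S t) (lam\<^sub>0 * circle_minus S (\<lambda>v. - A v) t)"
      using cylinder_neg_le[OF \<mu>_nonneg A_nonneg[OF t] reg[OF t] assms(15,16)]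
      by (simp add: circle_minus_def)
  qed auto

  \<comment> \<open>The hypothesis on \<open>lam\<^sub>0\<close> speaks of a definite description
    and yields a usable bound only once its integrand is known to have an antiderivative.\<close>
  have delay: "\<exists>Z. (\<forall>u\<in>S. has_delta_derivative S Z (exp (J (fwd_jump S t) - J (max t\<^sub>0 (D u))) * A u) u)
      \<and> Z t - Z (max t\<^sub>0 (D t)) < 1 - lam\<^sub>0" if t: "t \<in> S" for t
  proof -
    let ?\<zeta> = "\<lambda>u. exp (J (fwd_jump S t) - J (max t\<^sub>0 (D u))) * A u"
    let ?\<eta> = "\<lambda>\<eta>. ts_exp S (\<lambda>u. lam\<^sub>0 * circle_minus S (\<lambda>v. - A v) u)
                (fwd_jump T t) (max t\<^sub>0 (delay_star T \<alpha> \<eta>)) * A \<eta>"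
    have "rd_continuous S (\<lambda>u. max t\<^sub>0 (D u))"
      by (rule rd_continuous_compose[OF D_rd closed_UNIV]) (auto intro: continuous_intros)
    moreover have "continuous_on S (\<lambda>q. exp (J (fwd_jump S t) - J q))"
    proof (intro continuous_intros)
      show "continuous_on S J"
        using J by (auto simp: continuous_on_eq_continuous_within has_delta_derivative_iff)
    qed
    ultimately have "rd_continuous S (\<lambda>u. exp (J (fwd_jump S t) - J (max t\<^sub>0 (D u))))"
      by (intro rd_continuous_compose[OF _ closed_S D_mem, where \<psi> = "\<lambda>q. exp (J (fwd_jump S t) - J q)"])
    then obtain Z where Z: "\<And>u. u \<in> S \<Longrightarrow> has_delta_derivative S Z (?\<zeta> u) u"
      using ex[OF rd_continuous_mult[OF _ assms(5)]] by metis
    have eq: "?\<eta> u = ?\<zeta> u" if u: "u \<in> S" for u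
      using ts_exp_eq[OF closed_S D_mem[OF u] jump_S[OF t] J] jump_T[OF t] D_T[OF u] by simp
    have "has_delta_derivative S Z (?\<eta> u) u" if "u \<in> S" for u
      unfolding eq[OF that] by (rule Z[OF that])
    from delta_integral_eq[OF closed_S D_mem[OF t] t this]
    have "Z t - Z (max t\<^sub>0 (D t)) < 1 - lam\<^sub>0" using assms(17)[OF t] D_T[OF t] by simp
    then show ?thesis using Z by metis
  qed

  have inv_set: "s \<in> {\<eta> \<in> T \<inter> {t\<^sub>0..}. delay_star T \<alpha> \<eta> \<le> s}" if s: "s \<in> S" for s
    using s D_self[OF s] D_T[OF s] assms(1) by simp
  \<comment> \<open>Since \<alpha> tends to infinity, \<open>delay_star\<close> eventually exceeds
    s. Without this bound the supremum in \<open>delay_inv\<close> would be unspecified.\<close>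
  have inv_bdd: "bdd_above {\<eta> \<in> T \<inter> {t\<^sub>0..}. delay_star T \<alpha> \<eta> \<le> s}" for s
  proof -
    obtain K where K: "\<And>r. K \<le> r \<Longrightarrow> r \<in> S \<Longrightarrow> s + 1 \<le> \<alpha> r"
      using assms(10) unfolding filterlim_at_top eventually_inf_principal eventually_at_top_linorder by metis
    show ?thesis
    proof (rule bdd_aboveI)
      fix r assume "r \<in> {\<eta> \<in> T \<inter> {t\<^sub>0..}. delay_star T \<alpha> \<eta> \<le> s}"
      then have r: "r \<in> S" "D r \<le> s" using assms(1) D_T by auto
      show "r \<le> K"
      proof (rule ccontr)
        assume "\<not> r \<le> K"
        then have "s + 1 \<le> D r" unfolding D_def
          by (intro delay_star_greatest[OF \<alpha>_bdd r(1)] K) auto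
        then show False using r by simp
      qed
    qed
  qed
  have inv_mem: "delay_inv T t\<^sub>0 \<alpha> s \<in> S" if s: "s \<in> S" for s
    unfolding delay_inv_def
    by (rule closed_subset_contains_Sup[OF closed_S _ _ inv_bdd]) (use inv_set[OF s] assms(1) in auto)
  have inv_ge: "s \<le> delay_inv T t\<^sub>0 \<alpha> s" if s: "s \<in> S" for s
    unfolding delay_inv_def by (rule cSup_upper[OF inv_set[OF s] inv_bdd])
  have inv_less: "s < D r" if "r \<in> S" "delay_inv T t\<^sub>0 \<alpha> s < r" for r s
  proof (rule ccontr)
    assume "\<not> s < D r"
    then have "r \<in> {\<eta> \<in> T \<inter> {t\<^sub>0..}. delay_star T \<alpha> \<eta> \<le> s}" using that(1) assms(1) D_T by auto
    then have "r \<le> delay_inv T t\<^sub>0 \<alpha> s" unfolding delay_inv_def by (rule cSup_upper[OF _ inv_bdd])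
    then show False using that(2) by simp
  qed
  \<comment> \<open>A natural number as bound also supplies \<open>0 \<le> Q\<close>.\<close>
  obtain n where n: "(SUP s\<in>S. ereal (delta_integral S A s (delay_inv T t\<^sub>0 \<alpha> s))) < ereal (real n)"
    using less_PInf_Ex_of_nat[THEN iffD1, OF less_imp_neq[OF assms(12)]] by (elim exE)
  define Q where "Q = real n"
  have Q: "H (delay_inv T t\<^sub>0 \<alpha> s) - H s \<le> Q" if s: "s \<in> S" for s
  proof -
    have "ereal (delta_integral S A s (delay_inv T t\<^sub>0 \<alpha> s)) \<le> ereal (real n)"
      by (rule order_trans[OF SUP_upper[OF s] less_imp_le[OF n]])
    then show ?thesis using delta_integral_eq[OF closed_S s inv_mem[OF s] H] by (simp add: Q_def)
  qed
  have Q0: "0 \<le> Q" by (simp add: Q_def)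
  \<comment> \<open>The first summand bounds the growth of e_A on the initial stretch, the second
    compensates the decay of w there. The stretch ends one jump after \<open>delay_inv\<close>, and
    that jump adds \<mu> A < 1 to the integral, hence Q + 1.\<close>
  define K where "K = exp ((Q + 1) + lam\<^sub>0 / (1 - lam\<^sub>0) * (Q + 1))"
  have K: "1 \<le> K" using Q0 assms(15,16) by (simp add: K_def)

  have main: "\<bar>x b\<bar> \<le> K * exp (I b - I s) * (\<bar>x\<^sub>0\<bar> + sup_abs (T \<inter> {delay_star T \<alpha> s..<s}) \<phi>)"
    if s: "s \<in> S" and sol: "delay_solution T A \<alpha> s x\<^sub>0 \<phi> x" and b: "b \<in> S" "s \<le> b" for s x\<^sub>0 \<phi> x b
  proof -
    \<comment> \<open>The solution may jump at \<open>s\<close> and is differentiable only relative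
      to [s, \<infinity>), so the comparisons are made on this smaller time scale.\<close>
    define Y where "Y = S \<inter> {s..}"
    have TY: "T \<inter> {s..} = Y" using s assms(1) by (auto simp: Y_def)
    have closed_Y: "closed Y" using closed_S by (auto simp: Y_def intro: closed_Int)
    have Y: "t \<in> S" "s \<le> t" if "t \<in> Y" for t using that by (auto simp: Y_def)
    have sY: "s \<in> Y" using s by (simp add: Y_def)
    have Y_graininess: "graininess Y t = graininess S t" if "t \<in> Y" for t
      using Y(2)[OF that] by (simp add: Y_def graininess_def fwd_jump_Int_atLeast)
    have to_Y: "has_delta_derivative Y f d t" if "has_delta_derivative S f d t" "t \<in> Y" for f d t
      unfolding Y_def by (rule has_delta_derivative_restrict[OF that(1) Y(2)[OF that(2)]])
    define N where "N = \<bar>x\<^sub>0\<bar> + sup_abs (T \<inter> {delay_star T \<alpha> s..<s}) \<phi>"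
    obtain x' where x': "\<And>t. t \<in> Y \<Longrightarrow> has_delta_derivative Y x (x' t) t"
      "\<And>t. t \<in> Y \<Longrightarrow> x' t = - (A t * x (\<alpha> t))"
      using sol unfolding delay_solution_def TY by (metis add_eq_0_iff2)
    have x_hist: "\<bar>x q\<bar> \<le> sup_abs (T \<inter> {D s..<s}) \<phi>" if q: "q \<in> T" "D s \<le> q" "q < s" for q
    proof -
      have "closed (T \<inter> {D s..s})" using closed_T by auto
      then obtain B where B: "\<forall>r\<in>T \<inter> {D s..s}. D s \<le> r \<longrightarrow> r \<le> s \<longrightarrow> \<bar>x r\<bar> \<le> B"
        using rd_continuous_bounded[of "T \<inter> {D s..s}" x "D s" s] sol D_T[OF s]
        unfolding delay_solution_def by auto
      have \<phi>: "\<And>r. r \<in> T \<inter> {D s..<s} \<Longrightarrow> x r = \<phi> r" using sol D_T[OF s] by (simp add: delay_solution_def)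
      have "\<bar>\<phi> q\<bar> \<le> sup_abs (T \<inter> {D s..<s}) \<phi>"
      proof (rule sup_abs_upper)
        fix r assume r: "r \<in> T \<inter> {D s..<s}"
        then have "\<bar>x r\<bar> \<le> B" using B by simp
        then show "\<bar>\<phi> r\<bar> \<le> B" using \<phi>[OF r] by simp
      qed (use q in simp)
      then show ?thesis using \<phi> q by simp
    qed
    have sup0: "0 \<le> sup_abs (T \<inter> {D s..<s}) \<phi>"
    proof (cases "T \<inter> {D s..<s} = {}")
      case False
      then obtain q where "q \<in> T" "D s \<le> q" "q < s" by auto
      then show ?thesis using x_hist[of q] by linarith
    qed (simp add: sup_abs_def)
    have hist: "\<bar>x q\<bar> \<le> N" if "q \<in> T" "D s \<le> q" "q < s" for q
      using x_hist[OF that] D_T[OF s] by (simp add: N_def)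
    have N0: "0 \<le> N" using sup0 D_T[OF s] by (simp add: N_def)
    have xs: "\<bar>x s\<bar> \<le> N" using sup0 sol D_T[OF s] by (simp add: N_def delay_solution_def)
    have past: "\<alpha> t \<in> T" "D s \<le> \<alpha> t" "\<alpha> t \<le> t" if "t \<in> Y" for t
      using assms(8,9) D_le Y[OF that] by auto
    have past_S: "q \<in> S" if "q \<in> T" "s \<le> q" for q using that assms(1) s by auto

    \<comment> \<open>At \<open>delay_inv\<close> itself the delay may still reach back before
      \<open>s\<close>. If that point is right-scattered, the next one is beyond it; if it is
      right-dense, right continuity of \<open>D\<close> already gives s \<le> D there.\<close>
    define s2 where "s2 = fwd_jump S (delay_inv T t\<^sub>0 \<alpha> s)"
    let ?s1 = "delay_inv T t\<^sub>0 \<alpha> s"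
    have s2: "s2 \<in> S" "?s1 \<le> s2" "s \<le> s2"
      using jump_S[OF inv_mem[OF s]] fwd_jump_ge[of ?s1 S] inv_ge[OF s] by (auto simp: s2_def)
    have late: "s \<le> D t" if t: "t \<in> S" "s2 \<le> t" for t
    proof (cases "?s1 < s2")
      case True
      then show ?thesis using inv_less[OF t(1), of s] t by simp
    next
      case False
      then have st: "fwd_jump S ?s1 = ?s1" using s2 by (simp add: s2_def)
      have ne: "S \<inter> {?s1<..} \<noteq> {}" using unbdd by (force simp: bdd_above_def not_le)
      have "s \<le> D ?s1"
      proof (rule ccontr)
        assume "\<not> s \<le> D ?s1"
        then have "0 < s - D ?s1" by simp
        then obtain d where d: "d > 0" "\<And>r. r \<in> S \<Longrightarrow> ?s1 \<le> r \<Longrightarrow> r < ?s1 + d \<Longrightarrow> \<bar>D r - D ?s1\<bar> < s - D ?s1"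
          using rd_continuous_right[OF D_rd inv_mem[OF s]] by metis
        obtain r where "r \<in> S" "?s1 < r" "r < ?s1 + d"
          using fwd_jump_dense[OF st, of _ "?s1 + d"] ne d(1) by auto
        then show False using d(2)[of r] inv_less[of r s] by simp
      qed
      also have "\<dots> \<le> D t" using t s2 by (intro D_mono) auto
      finally show ?thesis .
    qed

    \<comment> \<open>Dividing by the positive factor isolates \<open>N\<close>, so that strict
      bounds with every \<open>N' > N\<close> yield the weak one. This also covers
      \<open>N = 0\<close>, where no strict bound could start.\<close>
    have "\<bar>x b\<bar> / (K * exp (I b - I s)) \<le> N"
    proof (rule dense_ge)
      fix N' assume N': "N < N'"
      then have N'0: "0 < N'" using N0 by simp
      \<comment> \<open>For v = N' e_A(., s) one has v' + A v = 2 A v, while |x' + A x| \<le> A (|x|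
        + |x o \<alpha>|). Both terms are at most v(r), since v is nondecreasing and the history is
        bounded by \<open>N\<close>, below v(s).\<close>
      have gronwall: "\<bar>x t\<bar> < N' * exp (- G s) * exp (G t)" if t: "t \<in> Y" for t
      proof (rule delta_comparison[OF closed_Y sY t Y(2)[OF t] x'(1)])
        fix r assume r: "r \<in> Y" "s \<le> r"
        show "has_delta_derivative Y (\<lambda>t. N' * exp (- G s) * exp (G t))
            (N' * exp (- G s) * (A r * exp (G r))) r"
          by (rule has_delta_derivative_cmult[OF to_Y[OF exp_G]]) (use r Y in auto)
        show "has_delta_derivative Y (\<lambda>t. exp (E t)) (- A r * exp (E r)) r"
          by (rule to_Y[OF exp_E]) (use r Y in auto)
        show "graininess Y r * A r < 1" using reg r Y Y_graininess by simp
        assume IH: "\<And>q. q \<in> Y \<Longrightarrow> s \<le> q \<Longrightarrow> q \<le> r \<Longrightarrow> \<bar>x q\<bar> < N' * exp (- G s) * exp (G q)"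
        have v_mono: "N' * exp (- G s) * exp (G p) \<le> N' * exp (- G s) * exp (G q)"
          if "p \<in> S" "q \<in> S" "p \<le> q" for p q
          using G_mono[OF that] N'0 by (intro mult_left_mono) auto
        have "\<bar>x (\<alpha> r)\<bar> \<le> N' * exp (- G s) * exp (G r)"
        proof (cases "s \<le> \<alpha> r")
          case True
          then have "\<alpha> r \<in> S" using past[OF r(1)] past_S by blast
          then show ?thesis
            using IH[of "\<alpha> r"] v_mono[of "\<alpha> r" r] past[OF r(1)] True r Y by (auto simp: Y_def)
        next
          case False
          then have "\<bar>x (\<alpha> r)\<bar> \<le> N" using hist past[OF r(1)] by simp
          also have "N \<le> N' * exp (- G s) * exp (G s)" using N' by (simp add: mult.assoc exp_add[symmetric])
          also have "\<dots> \<le> N' * exp (- G s) * exp (G r)" using v_mono[OF s] r Y by auto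
          finally show ?thesis .
        qed
        moreover have "\<bar>x r\<bar> \<le> N' * exp (- G s) * exp (G r)" using IH[OF r order_refl] by simp
        ultimately have "\<bar>x r\<bar> + \<bar>x (\<alpha> r)\<bar> \<le> 2 * (N' * exp (- G s) * exp (G r))" by linarith
        then have "A r * (\<bar>x r\<bar> + \<bar>x (\<alpha> r)\<bar>) \<le> A r * (2 * (N' * exp (- G s) * exp (G r)))"
          using A_nonneg Y r by (intro mult_left_mono) auto
        moreover have "\<bar>x' r + A r * x r\<bar> \<le> A r * (\<bar>x r\<bar> + \<bar>x (\<alpha> r)\<bar>)"
        proof -
          have "x' r + A r * x r = A r * (x r - x (\<alpha> r))" using x'(2)[OF r(1)] by (simp add: algebra_simps)
          then have "\<bar>x' r + A r * x r\<bar> = A r * \<bar>x r - x (\<alpha> r)\<bar>"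
            using A_nonneg Y r by (simp add: abs_mult)
          also have "\<dots> \<le> A r * (\<bar>x r\<bar> + \<bar>x (\<alpha> r)\<bar>)"
            using A_nonneg Y r by (intro mult_left_mono abs_triangle_ineq4) auto
          finally show ?thesis .
        qed
        ultimately show "\<bar>x' r + A r * x r\<bar>
            \<le> N' * exp (- G s) * (A r * exp (G r)) + A r * (N' * exp (- G s) * exp (G r))"
          by (simp add: algebra_simps)
      next
        show "\<bar>x s\<bar> < N' * exp (- G s) * exp (G s)"
          using xs N' by (simp add: mult.assoc exp_add[symmetric])
      qed auto

      \<comment> \<open>Normalized so that \<open>C * exp (I t)\<close> equals N' K w(t) with w(s) =
        1.\<close>
      define C where "C = N' * K * exp (- I s)"
      have C: "0 < C" using N'0 K by (simp add: C_def)
      have early: "\<bar>x t\<bar> < C * exp (I t)" if t: "t \<in> Y" "t \<le> s2" for t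
      proof -
        note tS = Y[OF t(1)]
        have "H t - H s \<le> H s2 - H s" using H_mono[OF tS(1) s2(1) t(2)] by simp
        also have "H s2 = H ?s1 + graininess S ?s1 * A ?s1"
          using H[OF inv_mem[OF s]] inv_mem[OF s] by (simp add: has_delta_derivative_iff s2_def)
        finally have Ht: "H t - H s \<le> Q + 1" using Q[OF s] reg[OF inv_mem[OF s]] by simp
        have "G t - G s \<le> Q + 1" using G_le_H[OF s tS] Ht by simp
        moreover have "- (lam\<^sub>0 / (1 - lam\<^sub>0) * (Q + 1)) \<le> I t - I s"
        proof -
          have "lam\<^sub>0 / (1 - lam\<^sub>0) * (H t - H s) \<le> lam\<^sub>0 / (1 - lam\<^sub>0) * (Q + 1)"
            using Ht assms(15,16) by (intro mult_left_mono) auto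
          then show ?thesis using I_ge_H[OF s tS] unfolding right_diff_distrib by linarith
        qed
        ultimately have "G t - G s \<le> (Q + 1) + lam\<^sub>0 / (1 - lam\<^sub>0) * (Q + 1) + (I t - I s)" by linarith
        then have "exp (G t - G s) \<le> K * exp (I t - I s)"
          unfolding K_def exp_add[symmetric] by simp
        then have "N' * exp (G t - G s) \<le> N' * (K * exp (I t - I s))"
          using N'0 by (intro mult_left_mono) auto
        then have "N' * exp (- G s) * exp (G t) \<le> C * exp (I t)"
          by (simp add: C_def exp_diff exp_minus field_simps)
        then show ?thesis using gronwall[OF t(1)] by simp
      qed
      have decay: "\<bar>x t\<bar> < C * exp (I t)" if t: "t \<in> Y" "s2 \<le> t" for t
      proof (rule delta_comparison[OF closed_Y _ t x'(1)])
        show s2Y: "s2 \<in> Y" using s2 by (simp add: Y_def)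
        show "\<bar>x s2\<bar> < C * exp (I s2)" by (rule early[OF s2Y order_refl])
        fix r assume r: "r \<in> Y" "s2 \<le> r"
        note rS = Y[OF r(1)]
        show "has_delta_derivative Y (\<lambda>t. C * exp (I t)) (C * (- lam\<^sub>0 * A r * exp (I r))) r"
          by (rule has_delta_derivative_cmult[OF to_Y[OF exp_I]]) (use r Y in auto)
        show "has_delta_derivative Y (\<lambda>t. exp (E t)) (- A r * exp (E r)) r"
          by (rule to_Y[OF exp_E]) (use r Y in auto)
        show "graininess Y r * A r < 1" using reg r Y Y_graininess by simp
        assume IH: "\<And>q. q \<in> Y \<Longrightarrow> s2 \<le> q \<Longrightarrow> q \<le> r \<Longrightarrow> \<bar>x q\<bar> < C * exp (I q)"
        \<comment> \<open>Joins three sources: the comparison hypothesis after \<open>s2\<close>,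
          \<open>early\<close> between \<open>s\<close> and \<open>s2\<close>, and the history
          before \<open>s\<close>, where \<open>exp (I q)\<close> is at least its value at
          \<open>s\<close>. The maximum stands for continuing w as a constant before
          \<open>t\<^sub>0\<close>.\<close>
        have x_le: "\<bar>x q\<bar> \<le> C * exp (I (max t\<^sub>0 q))" if q: "q \<in> T" "D s \<le> q" "q \<le> r" for q
        proof (cases "s \<le> q")
          case True
          then have qY: "q \<in> Y" using q past_S by (simp add: Y_def)
          then have "\<bar>x q\<bar> < C * exp (I q)" using early[of q] IH[of q] q by (cases "q \<le> s2") auto
          moreover have "max t\<^sub>0 q = q" using Y(1)[OF qY] S(2) by auto
          ultimately show ?thesis by simp
        next
          case False
          then have "\<bar>x q\<bar> \<le> N" using hist q by simp
          also have "N \<le> N' * K" using N' N'0 K by (smt (verit) mult_left_le mult_le_cancel_left1)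
          also have "\<dots> = C * exp (I s)" by (simp add: C_def mult.assoc exp_add[symmetric])
          also have "\<dots> \<le> C * exp (I (max t\<^sub>0 q))"
          proof -
            have "max t\<^sub>0 q \<in> S" using q assms(1,4) by (auto simp: max_def)
            then have "I s \<le> I (max t\<^sub>0 q)" using False s S(2) by (intro I_anti) auto
            then show ?thesis using C by simp
          qed
          finally show ?thesis .
        qed
        obtain Z where Z: "\<And>u. u \<in> S \<Longrightarrow>
              has_delta_derivative S Z (exp (J (fwd_jump S r) - J (max t\<^sub>0 (D u))) * A u) u"
            "Z r - Z (max t\<^sub>0 (D r)) < 1 - lam\<^sub>0"
          using delay[OF rS(1)] by metis
        \<comment> \<open>Taken at \<sigma>(r) to match the exponential in the hypothesis: w at the
          delayed time is at most w(\<sigma>(r)) times that exponential, so \<open>c\<close> factors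
          out of the bound for |x'| on the whole integration range.\<close>
        define c where "c = C * exp (I (fwd_jump S r))"
        have c: "0 < c" "c \<le> C * exp (I r)"
          using C I_anti[OF rS(1) jump_S[OF rS(1)] fwd_jump_ge] by (auto simp: c_def)
        have x'_le: "\<bar>x' u\<bar> \<le> c * (exp (J (fwd_jump S r) - J (max t\<^sub>0 (D u))) * A u)"
          if u: "u \<in> Y" "u \<le> r" for u
        proof -
          note uS = Y[OF u(1)]
          have ru: "max t\<^sub>0 (D u) \<le> max t\<^sub>0 (\<alpha> u)" using D_le[OF uS(1) order_refl] by auto
          have "\<bar>x (\<alpha> u)\<bar> \<le> C * exp (I (max t\<^sub>0 (\<alpha> u)))"
            using past[OF u(1)] u by (intro x_le) auto
          also have "\<dots> \<le> C * exp (I (max t\<^sub>0 (D u)))"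
          proof -
            have "max t\<^sub>0 (\<alpha> u) \<in> S" using past(1)[OF u(1)] assms(1,4) by (auto simp: max_def)
            then show ?thesis using I_anti[OF D_mem[OF uS(1)] _ ru] C by simp
          qed
          also have "\<dots> \<le> c * exp (J (fwd_jump S r) - J (max t\<^sub>0 (D u)))"
          proof -
            have "max t\<^sub>0 (D u) \<le> fwd_jump S r"
              using D_self[OF uS(1)] u rS S(2) fwd_jump_ge[of r S] by auto
            then have "I (max t\<^sub>0 (D u)) \<le> I (fwd_jump S r) + (J (fwd_jump S r) - J (max t\<^sub>0 (D u)))"
              using I_le_J[OF D_mem[OF uS(1)] jump_S[OF rS(1)]] by simp
            then show ?thesis using C by (simp add: c_def mult.assoc exp_add[symmetric])
          qed
          finally have "A u * \<bar>x (\<alpha> u)\<bar> \<le> A u * (c * exp (J (fwd_jump S r) - J (max t\<^sub>0 (D u))))"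
            using A_nonneg[OF uS(1)] by (rule mult_left_mono)
          then show ?thesis using x'(2)[OF u(1)] A_nonneg[OF uS(1)] by (simp add: abs_mult mult_ac)
        qed
        \<comment> \<open>From here the whole interval [\<alpha>(r), r] lies in \<open>Y\<close>, so
          the difference x(r) - x(\<alpha>(r)) can be estimated through x'.\<close>
        have \<alpha>r: "s \<le> \<alpha> r" using late[OF rS(1) r(2)] D_le[OF rS(1) order_refl] by simp
        then have \<alpha>Y: "\<alpha> r \<in> Y" "\<alpha> r \<le> r" using past[OF r(1)] past_S by (auto simp: Y_def)
        have cZ: "has_delta_derivative Y (\<lambda>u. c * Z u) (c * (exp (J (fwd_jump S r) - J (max t\<^sub>0 (D u))) * A u)) u"
          if "u \<in> Y" for u
          by (rule has_delta_derivative_cmult[OF to_Y[OF Z(1)]]) (use that Y in auto)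
        have "x r - x (\<alpha> r) \<le> c * Z r - c * Z (\<alpha> r)"
          by (rule delta_derivative_mono[OF closed_Y \<alpha>Y(1) r(1) \<alpha>Y(2) x'(1) cZ])
            (use x'_le abs_le_D1 in auto)
        moreover have "- 1 * x r - - 1 * x (\<alpha> r) \<le> c * Z r - c * Z (\<alpha> r)"
          by (rule delta_derivative_mono[OF closed_Y \<alpha>Y(1) r(1) \<alpha>Y(2) has_delta_derivative_cmult[OF x'(1)] cZ])
            (use x'_le abs_le_D2 in auto)
        ultimately have "\<bar>x r - x (\<alpha> r)\<bar> \<le> c * (Z r - Z (\<alpha> r))" by (simp add: abs_le_iff algebra_simps)
        \<comment> \<open>The integrand is nonnegative, so the range may be enlarged from
          [\<alpha>(r), r] to the one in the hypothesis.\<close>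
        also have "\<dots> \<le> c * (Z r - Z (max t\<^sub>0 (D r)))"
        proof -
          have "max t\<^sub>0 (D r) \<le> \<alpha> r" using D_le[OF rS(1) order_refl] \<alpha>r s S(2) by auto
          then have "Z (max t\<^sub>0 (D r)) \<le> Z (\<alpha> r)"
            by (rule delta_derivative_nonneg_mono[OF closed_S D_mem[OF rS(1)] Y(1)[OF \<alpha>Y(1)] _ Z(1)])
              (auto intro!: mult_nonneg_nonneg A_nonneg)
          then show ?thesis using c by simp
        qed
        also have "\<dots> \<le> c * (1 - lam\<^sub>0)" using Z(2) c by simp
        also have "\<dots> \<le> C * exp (I r) * (1 - lam\<^sub>0)" using c assms(16) by (intro mult_right_mono) auto
        finally have "A r * \<bar>x r - x (\<alpha> r)\<bar> \<le> A r * (C * exp (I r) * (1 - lam\<^sub>0))"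
          using A_nonneg[OF rS(1)] by (rule mult_left_mono)
        moreover have "x' r + A r * x r = A r * (x r - x (\<alpha> r))" using x'(2)[OF r(1)] by (simp add: algebra_simps)
        then have "\<bar>x' r + A r * x r\<bar> = A r * \<bar>x r - x (\<alpha> r)\<bar>"
          using A_nonneg[OF rS(1)] by (simp add: abs_mult)
        ultimately show "\<bar>x' r + A r * x r\<bar> \<le> C * (- lam\<^sub>0 * A r * exp (I r)) + A r * (C * exp (I r))"
          by (simp add: algebra_simps)
      qed auto
      have "b \<in> Y" using b by (simp add: Y_def)
      then have "\<bar>x b\<bar> < C * exp (I b)" using early[of b] decay[of b] by (cases "b \<le> s2") auto
      also have "\<dots> = N' * (K * exp (I b - I s))" by (simp add: C_def exp_diff exp_minus field_simps)
      finally show "\<bar>x b\<bar> / (K * exp (I b - I s)) \<le> N'" using K by (simp add: divide_le_eq)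
    qed
    then show ?thesis using K by (simp add: divide_le_eq N_def mult_ac)
  qed

  show ?thesis
    unfolding uniformly_exponentially_stable_def
  proof (intro exI conjI ballI allI impI)
    show "0 < K * M\<^sub>1" using K assms(18) by simp
    show "0 < lam\<^sub>1" by (rule assms(19))
    fix s x\<^sub>0 \<phi> x t
    assume st: "s \<in> T \<inter> {t\<^sub>0..}" "t \<in> T \<inter> {s..}" and sol: "delay_solution T A \<alpha> s x\<^sub>0 \<phi> x"
    let ?N = "\<bar>x\<^sub>0\<bar> + sup_abs (T \<inter> {delay_star T \<alpha> s..<s}) \<phi>"
    let ?e = "ts_exp S (circle_minus S (\<lambda>_. lam\<^sub>1)) t s"
    have s: "s \<in> S" and t: "t \<in> S" "s \<le> t" using st assms(1) by auto
    have x: "\<bar>x t\<bar> \<le> K * exp (I t - I s) * ?N" by (rule main[OF s sol t])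
    have "exp (I t - I s) \<le> M\<^sub>1 * ?e"
      using assms(20)[of t s] ts_exp_eq[OF closed_S s t(1) I] st t(2) by simp
    \<comment> \<open>Read off from the estimate just obtained: a positive multiple of
      \<open>?N\<close> bounds an absolute value.\<close>
    moreover have "0 \<le> ?N"
    proof -
      have "0 \<le> K * exp (I t - I s) * ?N" using x by (rule order_trans[OF abs_ge_zero])
      moreover have "0 < K * exp (I t - I s)" using K by simp
      ultimately show ?thesis unfolding zero_le_mult_iff by linarith
    qed
    ultimately have "K * exp (I t - I s) * ?N \<le> K * (M\<^sub>1 * ?e) * ?N"
      using K by (intro mult_right_mono mult_left_mono) auto
    then show "\<bar>x t\<bar> \<le> K * M\<^sub>1 * ts_exp (T \<inter> {t\<^sub>0..}) (circle_minus (T \<inter> {t\<^sub>0..}) (\<lambda>_. lam\<^sub>1)) t s * ?N"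
      using x unfolding assms(1)[symmetric] by (simp add: mult.assoc)
  qed
qed

end
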